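(* Let $n\ge 3$ and $m\ge 2$ be integers. Then the following assertions hold. (1) If $3\nmid m$, then $T_n[m]/T_n[3m]\cong A_n$, where $A_n$ is the alternating group on $n$ letters. (2) If $m$ is odd, then $T_n[m]/T_n[4m]\cong H$, where $H$ is the subgroup of $W_{n,2}$ consisting of words of even length. (3) If $m$ is odd and $3\nmid m$, then $T_n[m]/T_n[12m]\cong A_n\times H$, with $A_n$ and $H$ as in (1) and (2).
   Context: The twin group is $T_n=\langle s_1,\dots,s_{n-1}\mid s_k^2=1 \text{ for all } k,\ s_is_j=s_js_i \text{ for } |i-j|\ge 2\rangle$. Its Tits representation $\rho:T_n\to \mathrm{GL}(n-1,\mathbb{Z})$ is given by $\rho(s_i)=X_i$, where $X_i$ is the matrix that agrees with the identity except in the $i$-th row, and whose $i$-th row has $(i,i)$-entry $-1$, $(i,i\pm1)$-entries $2$ (whenever $1\le i\pm1\le n-1$) and all other entries $0$. For $m\ge2$, the principal congruence subgroup $T_n[m]$ of level $m$ is the kernel of the composition of $\rho$ with the reduction $\mathrm{GL}(n-1,\mathbb{Z})\to\mathrm{GL}(n-1,\mathbb{Z}/m\mathbb{Z})$. $W_{n,2}$ is the Coxeter group $\langle u_1,\dots,u_{n-1}\mid u_i^2=1,\ (u_iu_j)^2=1 \text{ for all } i\ne j\rangle\cong(\mathbb{Z}/2\mathbb{Z})^{n-1}$; a word of even length is a product of an even number of the generators $u_i$.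
   Formalization: Part (1) is stated for m ≠ 2 only: at m = 2 it is false for every n ≥ 3, because every X_i is the identity mod 2, so T_n[2] = T_n, T_n[6] = T_n[3], and T_n[2]/T_n[6] is the full symmetric group S_n rather than A_n. *)

theory Defs
  imports
    "HOL-Algebra.Sym_Groups"
    "Jordan_Normal_Form.Matrix"
begin

section \<open>Groups given by generators and relations\<close>

text \<open>
  Words are lists of signed letters: \<open>(True, a)\<close> stands for the generator \<open>a\<close> and
  \<open>(False, a)\<close> for its formal inverse. A relation \<open>l = r\<close> is given as the pair \<open>(l, r)\<close>.
\<close>

type_synonym 'a sword = "(bool \<times> 'a) list"

definition swords :: "'a set \<Rightarrow> 'a sword set" where
  "swords S = lists (UNIV \<times> S)"

definition gens :: "'a list \<Rightarrow> 'a sword" where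
  "gens w = map (Pair True) w"

inductive word_eq :: "'a set \<Rightarrow> ('a sword \<times> 'a sword) set \<Rightarrow> 'a sword \<Rightarrow> 'a sword \<Rightarrow> bool"
  for S :: "'a set" and R :: "('a sword \<times> 'a sword) set" where
  refl: "word_eq S R u u"
| sym: "word_eq S R u v \<Longrightarrow> word_eq S R v u"
| trans: "word_eq S R u v \<Longrightarrow> word_eq S R v w \<Longrightarrow> word_eq S R u w"
| cancel: "a \<in> S \<Longrightarrow> word_eq S R (u @ [(b, a), (\<not> b, a)] @ v) (u @ v)"
| relation: "(l, r) \<in> R \<Longrightarrow> word_eq S R (u @ l @ v) (u @ r @ v)"

definition word_rel :: "'a set \<Rightarrow> ('a sword \<times> 'a sword) set \<Rightarrow> ('a sword \<times> 'a sword) set" where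
  "word_rel S R = {(u, v). u \<in> swords S \<and> v \<in> swords S \<and> word_eq S R u v}"

definition presented_group ::
    "'a set \<Rightarrow> ('a sword \<times> 'a sword) set \<Rightarrow> 'a sword set monoid" where
  "presented_group S R =
     \<lparr> carrier = swords S // word_rel S R,
       mult = (\<lambda>A B. \<Union>u\<in>A. \<Union>v\<in>B. word_rel S R `` {u @ v}),
       one = word_rel S R `` {[]} \<rparr>"

text \<open>
  The homomorphism from a presented group into \<open>G\<close> that sends each generator \<open>a\<close> to \<open>f a\<close>.
  It is meaningful when \<open>f\<close> maps generators into \<open>G\<close> and respects the relations: all words in
  a class then have the same value.
\<close>

fun word_value :: "('g, 'x) monoid_scheme \<Rightarrow> ('a \<Rightarrow> 'g) \<Rightarrow> 'a sword \<Rightarrow> 'g" where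
  "word_value G f [] = \<one>\<^bsub>G\<^esub>"
| "word_value G f ((b, a) # w) =
     (if b then f a else inv\<^bsub>G\<^esub> (f a)) \<otimes>\<^bsub>G\<^esub> word_value G f w"

definition induced_hom :: "('g, 'x) monoid_scheme \<Rightarrow> ('a \<Rightarrow> 'g) \<Rightarrow> 'a sword set \<Rightarrow> 'g" where
  "induced_hom G f A = the_elem (word_value G f ` A)"


section \<open>Twin groups\<close>

definition twin_relations :: "nat \<Rightarrow> (nat sword \<times> nat sword) set" where
  "twin_relations n =
     {(gens [k, k], []) | k. k \<in> {1..n-1}} \<union>
     {(gens [i, j], gens [j, i]) | i j.
        i \<in> {1..n-1} \<and> j \<in> {1..n-1} \<and> \<bar>int i - int j\<bar> \<ge> 2}"

definition twin_group :: "nat \<Rightarrow> nat sword set monoid" where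
  "twin_group n = presented_group {1..n-1} (twin_relations n)"


section \<open>The Tits representation and principal congruence subgroups\<close>

definition GL_int :: "nat \<Rightarrow> int mat monoid" where
  "GL_int k = units_of (ring_mat TYPE(int) k ())"

text \<open>Matrices over \<open>\<int>/m\<int>\<close> are represented by their entries in \<open>{0..<m}\<close>.\<close>

definition reduce_mat :: "nat \<Rightarrow> int mat \<Rightarrow> int mat" where
  "reduce_mat m = map_mat (\<lambda>x. x mod int m)"

definition mat_mod :: "nat \<Rightarrow> nat \<Rightarrow> int mat monoid" where
  "mat_mod k m =
     \<lparr> carrier = {A \<in> carrier_mat k k. elements_mat A \<subseteq> {0..<int m}},
       mult = (\<lambda>A B. reduce_mat m (A * B)),
       one = reduce_mat m (1\<^sub>m k) \<rparr>"

definition GL_mod :: "nat \<Rightarrow> nat \<Rightarrow> int mat monoid" where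
  "GL_mod k m = units_of (mat_mod k m)"

text \<open>
  Rows and columns of the matrix \<open>X\<^sub>i\<close> are numbered from \<open>1\<close> to \<open>n - 1\<close>, whereas the indices of
  \<^const>\<open>mat\<close> start at \<open>0\<close>; hence the shift by one.
\<close>

definition tits_entry :: "nat \<Rightarrow> nat \<Rightarrow> nat \<Rightarrow> int" where
  "tits_entry i r c =
     (if r \<noteq> i then (if r = c then 1 else 0)
      else if c = i then -1
      else if c = i + 1 \<or> c + 1 = i then 2
      else 0)"

definition tits_mat :: "nat \<Rightarrow> nat \<Rightarrow> int mat" where
  "tits_mat n i = mat (n - 1) (n - 1) (\<lambda>(r, c). tits_entry i (r + 1) (c + 1))"

definition tits_rep :: "nat \<Rightarrow> nat sword set \<Rightarrow> int mat" where
  "tits_rep n = induced_hom (GL_int (n - 1)) (tits_mat n)"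

definition congruence_subgroup :: "nat \<Rightarrow> nat \<Rightarrow> nat sword set set" where
  "congruence_subgroup n m =
     kernel (twin_group n) (GL_mod (n - 1) m) (reduce_mat m \<circ> tits_rep n)"

text \<open>
  The level \<open>2\<close> is degenerate: every \<open>X\<^sub>i\<close> is congruent to the identity modulo \<open>2\<close>, so
  \<open>T\<^sub>n[2] = T\<^sub>n\<close>, and \<open>T\<^sub>n[2] / T\<^sub>n[6]\<close> is the full symmetric group, not the alternating one.
\<close>

text \<open>
  The quotient \<open>T\<^sub>n[m] / T\<^sub>n[k]\<close>, to be used when \<open>m dvd k\<close>, so that
  \<open>T\<^sub>n[k] \<subseteq> T\<^sub>n[m]\<close>.
\<close>

definition congruence_quotient :: "nat \<Rightarrow> nat \<Rightarrow> nat \<Rightarrow> nat sword set set monoid" where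
  "congruence_quotient n m k =
     (twin_group n \<lparr>carrier := congruence_subgroup n m\<rparr>) Mod congruence_subgroup n k"


section \<open>The Coxeter group \<open>W\<^sub>n\<^sub>,\<^sub>2\<close> and its words of even length\<close>

definition coxeter2_relations :: "nat \<Rightarrow> (nat sword \<times> nat sword) set" where
  "coxeter2_relations n =
     {(gens [i, i], []) | i. i \<in> {1..n-1}} \<union>
     {(gens [i, j, i, j], []) | i j. i \<in> {1..n-1} \<and> j \<in> {1..n-1} \<and> i \<noteq> j}"

definition coxeter2_group :: "nat \<Rightarrow> nat sword set monoid" where
  "coxeter2_group n = presented_group {1..n-1} (coxeter2_relations n)"

definition even_words :: "nat \<Rightarrow> nat sword set set" where
  "even_words n =
     {word_rel {1..n-1} (coxeter2_relations n) `` {gens w} | w.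
        w \<in> lists {1..n-1} \<and> even (length w)}"

definition even_word_group :: "nat \<Rightarrow> nat sword set monoid" where
  "even_word_group n = coxeter2_group n \<lparr>carrier := even_words n\<rparr>"

end

theory Submission
  imports Defs "HOL-Number_Theory.Cong" "Jordan_Normal_Form.Determinant"
begin

text \<open>
  Let \<open>G\<^sub>3\<close> and \<open>G\<^sub>4\<close> be the images of \<open>T\<^sub>n\<close> in \<open>GL (n - 1)\<close> modulo \<open>3\<close> and modulo \<open>4\<close>. The
  first is the symmetric group: after changing the signs of every second basis vector, \<open>X\<^sub>i\<close> becomes
  modulo \<open>3\<close> the transposition \<open>(i, i + 1)\<close> acting on the root lattice of type \<open>A\<close>, and this action
  is faithful modulo \<open>3\<close> for \<open>n \<ge> 3\<close> (\<open>word_perm_eq_id_iff\<close>). The second is \<open>W\<^sub>n\<^sub>,\<^sub>2\<close>: since \<open>X\<^sub>i\<close> is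
  \<open>1\<close> modulo \<open>2\<close>, multiplying the matrices modulo \<open>4\<close> amounts to adding the matrices
  \<open>(X\<^sub>i - 1) / 2\<close> modulo \<open>2\<close>, and these are linearly independent (\<open>parity_rep_kernel\<close>). So \<open>T\<^sub>n[3]\<close>
  and \<open>T\<^sub>n[4]\<close> are the kernels of the homomorphisms \<open>perm_rep\<close> to \<open>S\<^sub>n\<close> and \<open>parity_rep\<close> to
  \<open>W\<^sub>n\<^sub>,\<^sub>2\<close>.

  If \<open>p\<close> is prime to \<open>m\<close>, then \<open>T\<^sub>n[p m] = T\<^sub>n[p] \<inter> T\<^sub>n[m]\<close>, and a homomorphism with kernel
  \<open>T\<^sub>n[p]\<close> identifies \<open>T\<^sub>n[m] / T\<^sub>n[p m]\<close> with the image of \<open>T\<^sub>n[m]\<close>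
  (\<open>congruence_quotient_iso_image\<close>). This image is computed in
  \<open>image_congruence_subgroup_eq_even_words\<close>: it is the image of the words of even length. It is no
  larger because \<open>det X\<^sub>i = -1\<close>, and \<open>1\<close> and \<open>-1\<close> differ modulo \<open>m \<ge> 3\<close>. It is no smaller because
  \<open>X\<^sub>i X\<^bsub>i + 1\<^esub>\<close> is unipotent and congruent to \<open>1\<close> modulo \<open>2\<close>, whence its \<open>m\<close>-th power is
  congruent to \<open>1\<close> modulo \<open>m\<close>; so \<open>(s\<^sub>i s\<^bsub>i + 1\<^esub>) ^ m\<close> lies in \<open>T\<^sub>n[m]\<close>, and its image generates
  the same cyclic group as the image of \<open>s\<^sub>i s\<^bsub>i + 1\<^esub>\<close>, which has order \<open>3\<close> in \<open>S\<^sub>n\<close> and \<open>2\<close> in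
  \<open>W\<^sub>n\<^sub>,\<^sub>2\<close>. Telescoping, these elements generate all even words. The even words map onto \<open>A\<^sub>n\<close> and
  onto \<open>H\<close>.

  For level \<open>12 m\<close> the two homomorphisms are combined. The image is all of \<open>A\<^sub>n \<times> H\<close>, because
  already \<open>T\<^sub>n[4 m]\<close>, on which \<open>parity_rep\<close> is trivial, maps onto \<open>A\<^sub>n\<close>, and \<open>T\<^sub>n[3 m]\<close>, on which
  \<open>perm_rep\<close> is trivial, maps onto \<open>H\<close>.
\<close>

section \<open>Groups given by generators and relations\<close>

lemma swords_simps [simp]:
  "[] \<in> swords S"
  "x # w \<in> swords S \<longleftrightarrow> snd x \<in> S \<and> w \<in> swords S"
  "u @ v \<in> swords S \<longleftrightarrow> u \<in> swords S \<and> v \<in> swords S"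
  by (auto simp: swords_def mem_Times_iff)

lemma gens_simps [simp]:
  "gens [] = []" "gens (a # w) = (True, a) # gens w" "gens (u @ v) = gens u @ gens v"
  "gens w \<in> swords S \<longleftrightarrow> w \<in> lists S"
proof -
  show "gens w \<in> swords S \<longleftrightarrow> w \<in> lists S"
    by (induction w) (auto simp: gens_def)
qed (simp_all add: gens_def)

lemma word_eq_context: "word_eq S R u v \<Longrightarrow> word_eq S R (x @ u @ y) (x @ v @ y)"
proof (induction rule: word_eq.induct)
  case (cancel a u b v)
  then show ?case using word_eq.cancel[of a S R "x @ u" b "v @ y"] by simp
next
  case (relation l r u v)
  then show ?case using word_eq.relation[of l r R S "x @ u" "v @ y"] by simp
qed (auto intro: word_eq.refl word_eq.sym word_eq.trans)

lemma word_eq_append: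
  "word_eq S R u u' \<Longrightarrow> word_eq S R v v' \<Longrightarrow> word_eq S R (u @ v) (u' @ v')"
  using word_eq_context[of S R u u' "[]" v] word_eq_context[of S R v v' u' "[]"]
  by (auto intro: word_eq.trans)

definition word_class :: "'a set \<Rightarrow> ('a sword \<times> 'a sword) set \<Rightarrow> 'a sword \<Rightarrow> 'a sword set" where
  "word_class S R w = word_rel S R `` {w}"

locale presentation =
  fixes S :: "'a set" and R :: "('a sword \<times> 'a sword) set"
  assumes relation_words: "(l, r) \<in> R \<Longrightarrow> l \<in> swords S \<and> r \<in> swords S"
begin

abbreviation cls :: "'a sword \<Rightarrow> 'a sword set" where
  "cls \<equiv> word_class S R"

abbreviation P :: "'a sword set monoid" where
  "P \<equiv> presented_group S R"

lemma equiv_word_rel: "equiv (swords S) (word_rel S R)"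
  by (rule equivI)
    (auto simp: word_rel_def refl_on_def sym_def trans_def
      intro: word_eq.refl word_eq.sym word_eq.trans)

lemma cls_eq_iff:
  "u \<in> swords S \<Longrightarrow> v \<in> swords S \<Longrightarrow> cls u = cls v \<longleftrightarrow> word_eq S R u v"
  unfolding word_class_def by (subst eq_equiv_class_iff[OF equiv_word_rel]) (auto simp: word_rel_def)

lemma mem_cls_iff: "u \<in> swords S \<Longrightarrow> v \<in> cls u \<longleftrightarrow> v \<in> swords S \<and> word_eq S R u v"
  by (auto simp: word_class_def word_rel_def)

lemma carrier_iff: "x \<in> carrier P \<longleftrightarrow> (\<exists>w\<in>swords S. x = cls w)"
  by (auto simp: presented_group_def quotient_def word_class_def)

lemma cls_closed: "w \<in> swords S \<Longrightarrow> cls w \<in> carrier P"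
  using carrier_iff by blast

lemma one_cls: "\<one>\<^bsub>P\<^esub> = cls []"
  by (simp add: presented_group_def word_class_def)

lemma mult_cls:
  assumes "u \<in> swords S" "v \<in> swords S"
  shows "cls u \<otimes>\<^bsub>P\<^esub> cls v = cls (u @ v)"
proof -
  have "cls (u' @ v') = cls (u @ v)" if "u' \<in> cls u" "v' \<in> cls v" for u' v'
  proof -
    have "u' \<in> swords S" "v' \<in> swords S" "word_eq S R u u'" "word_eq S R v v'"
      using that assms by (simp_all only: mem_cls_iff)
    then have "word_eq S R (u' @ v') (u @ v)"
      by (blast intro: word_eq.sym[OF word_eq_append])
    then show ?thesis
      using assms \<open>u' \<in> swords S\<close> \<open>v' \<in> swords S\<close> by (subst cls_eq_iff) simp_all
  qed
  moreover have "u \<in> cls u" "v \<in> cls v"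
    using assms by (simp_all only: mem_cls_iff word_eq.refl simp_thms)
  ultimately have "(\<Union>u'\<in>cls u. \<Union>v'\<in>cls v. cls (u' @ v')) = cls (u @ v)"
    by blast
  then show ?thesis
    by (simp add: presented_group_def word_class_def)
qed

lemma word_eq_inverse:
  assumes "w \<in> swords S"
  shows "word_eq S R (rev (map (\<lambda>(b, a). (\<not> b, a)) w) @ w) []"
  using assms
proof (induction w)
  case (Cons x w)
  obtain b a where x: "x = (b, a)" by (cases x)
  let ?v = "rev (map (\<lambda>(b, a). (\<not> b, a)) w)"
  have "word_eq S R (?v @ [(\<not> b, a), (\<not> \<not> b, a)] @ w) (?v @ w)"
    using Cons.prems x by (intro word_eq.cancel) auto
  moreover have "word_eq S R (?v @ w) []"
    using Cons by simp
  ultimately have "word_eq S R (?v @ [(\<not> b, a), (\<not> \<not> b, a)] @ w) []"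
    by (rule word_eq.trans)
  then show ?case using x by simp
qed (auto intro: word_eq.refl)

lemma group_P: "group P"
proof (rule groupI)
  show "\<exists>y\<in>carrier P. y \<otimes>\<^bsub>P\<^esub> x = \<one>\<^bsub>P\<^esub>" if x: "x \<in> carrier P" for x
  proof -
    obtain w where w: "w \<in> swords S" "x = cls w"
      using x by (auto simp: carrier_iff)
    have v: "rev (map (\<lambda>(b, a). (\<not> b, a)) w) \<in> swords S"
      using w(1) by (induction w) auto
    have "cls (rev (map (\<lambda>(b, a). (\<not> b, a)) w)) \<otimes>\<^bsub>P\<^esub> x = \<one>\<^bsub>P\<^esub>"
      unfolding w(2) one_cls mult_cls[OF v w(1)]
      using v w(1) word_eq_inverse[OF w(1)] by (subst cls_eq_iff) simp_all
    then show ?thesis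
      using cls_closed[OF v] by (rule bexI)
  qed
  show "x \<otimes>\<^bsub>P\<^esub> y \<in> carrier P" if carr: "x \<in> carrier P" "y \<in> carrier P" for x y
  proof -
    obtain u v where "u \<in> swords S" "v \<in> swords S" "x = cls u" "y = cls v"
      using carr unfolding carrier_iff by blast
    then show ?thesis by (simp only: mult_cls cls_closed swords_simps simp_thms)
  qed
  show "\<one>\<^bsub>P\<^esub> \<in> carrier P"
    unfolding one_cls by (intro cls_closed) simp
  show "x \<otimes>\<^bsub>P\<^esub> y \<otimes>\<^bsub>P\<^esub> z = x \<otimes>\<^bsub>P\<^esub> (y \<otimes>\<^bsub>P\<^esub> z)"
    if carr: "x \<in> carrier P" "y \<in> carrier P" "z \<in> carrier P" for x y z
  proof -
    obtain u v w where "u \<in> swords S" "v \<in> swords S" "w \<in> swords S"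
      "x = cls u" "y = cls v" "z = cls w"
      using carr unfolding carrier_iff by blast
    then show ?thesis by (simp add: mult_cls)
  qed
  show "\<one>\<^bsub>P\<^esub> \<otimes>\<^bsub>P\<^esub> x = x" if carr: "x \<in> carrier P" for x
  proof -
    obtain u where "u \<in> swords S" "x = cls u"
      using carr unfolding carrier_iff by blast
    then show ?thesis using mult_cls[of "[]" u] by (simp add: one_cls)
  qed
qed

text \<open>
  The universal property: an assignment of group elements to the generators extends to the
  presented group as soon as it satisfies the defining relations.
\<close>

context
  fixes H :: "('g, 'x) monoid_scheme" and f :: "'a \<Rightarrow> 'g"
  assumes group_H: "group H"
    and f_closed: "a \<in> S \<Longrightarrow> f a \<in> carrier H"
    and f_relation: "(l, r) \<in> R \<Longrightarrow> word_value H f l = word_value H f r"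
begin

interpretation H: group H by (fact group_H)

lemma word_value_closed: "w \<in> swords S \<Longrightarrow> word_value H f w \<in> carrier H"
proof (induction w)
  case (Cons x w)
  then show ?case using f_closed by (cases x) auto
qed auto

lemma word_value_append:
  "u \<in> swords S \<Longrightarrow> v \<in> swords S \<Longrightarrow>
    word_value H f (u @ v) = word_value H f u \<otimes>\<^bsub>H\<^esub> word_value H f v"
proof (induction u)
  case Nil
  then show ?case by (simp add: word_value_closed)
next
  case (Cons x u)
  then show ?case
    using f_closed word_value_closed by (cases x) (simp add: H.m_assoc)
qed

text \<open>
  The relation \<^const>\<open>word_eq\<close> also relates words with letters outside \<open>S\<close>, for which the
  value is meaningless; hence the first conjunct.
\<close>

lemma word_eq_imp_word_value_eq:
  "word_eq S R u v \<Longrightarrow>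
    (u \<in> swords S \<longleftrightarrow> v \<in> swords S) \<and> (u \<in> swords S \<longrightarrow> word_value H f u = word_value H f v)"
proof (induction rule: word_eq.induct)
  case (cancel a u b v)
  then show ?case
    using f_closed word_value_closed[of v]
    by (auto simp: word_value_append H.m_assoc[symmetric])
next
  case (relation l r u v)
  then show ?case
    using relation_words[OF relation] f_relation[OF relation] by (auto simp: word_value_append)
qed auto

lemma induced_hom_cls:
  assumes "w \<in> swords S"
  shows "induced_hom H f (cls w) = word_value H f w"
proof -
  have "w \<in> cls w"
    using assms by (simp add: mem_cls_iff word_eq.refl)
  moreover have "word_value H f v = word_value H f w" if "v \<in> cls w" for v
    using that assms word_eq_imp_word_value_eq[of w v] by (simp add: mem_cls_iff)
  ultimately have "word_value H f ` cls w = {word_value H f w}"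
    by blast
  then show ?thesis by (simp add: induced_hom_def)
qed

lemma induced_hom_hom: "induced_hom H f \<in> hom P H"
proof (rule homI)
  fix x y
  assume "x \<in> carrier P" "y \<in> carrier P"
  then obtain u v where "u \<in> swords S" "v \<in> swords S" "x = cls u" "y = cls v"
    unfolding carrier_iff by blast
  then show "induced_hom H f (x \<otimes>\<^bsub>P\<^esub> y) = induced_hom H f x \<otimes>\<^bsub>H\<^esub> induced_hom H f y"
    by (simp only: mult_cls induced_hom_cls word_value_append swords_simps simp_thms)
next
  fix x
  assume "x \<in> carrier P"
  then obtain u where "u \<in> swords S" "x = cls u"
    unfolding carrier_iff by blast
  then show "induced_hom H f x \<in> carrier H"
    by (simp only: induced_hom_cls word_value_closed)
qed

end

end

text \<open>
  When all generators are involutions, formal inverses can be dropped: every element is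
  represented by a word without them.
\<close>

locale involutive_presentation = presentation +
  assumes square_relation: "a \<in> S \<Longrightarrow> (gens [a, a], []) \<in> R"
begin

abbreviation elt :: "'a list \<Rightarrow> 'a sword set" where
  "elt w \<equiv> cls (gens w)"

lemma word_eq_square: "a \<in> S \<Longrightarrow> word_eq S R (gens (u @ [a, a] @ v)) (gens (u @ v))"
  using word_eq.relation[OF square_relation, of a S "gens u" "gens v"] by simp

lemma word_eq_gens: "w \<in> swords S \<Longrightarrow> word_eq S R w (gens (map snd w))"
proof (induction w)
  case (Cons x w)
  obtain b a where x: "x = (b, a)" by (cases x)
  have a: "a \<in> S" using Cons.prems x by simp
  have "word_eq S R [(False, a)] [(True, a)]"
  proof (rule word_eq.trans)
    show "word_eq S R [(False, a)] ([(False, a)] @ gens [a, a] @ [])"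
      using word_eq.relation[OF square_relation[OF a], of S "[(False, a)]" "[]"]
      by (simp add: word_eq.sym)
    show "word_eq S R ([(False, a)] @ gens [a, a] @ []) [(True, a)]"
      using word_eq.cancel[OF a, of R "[]" False "[(True, a)]"] by simp
  qed
  then have "word_eq S R [x] [(True, a)]"
    using x by (cases b) (auto intro: word_eq.refl)
  then have "word_eq S R ([x] @ w) ([(True, a)] @ gens (map snd w))"
    using Cons by (simp only: word_eq_append swords_simps simp_thms)
  then show ?case using x by simp
qed (auto intro: word_eq.refl)

lemma carrier_elt: "x \<in> carrier P \<longleftrightarrow> (\<exists>w\<in>lists S. x = elt w)"
proof
  assume "x \<in> carrier P"
  then obtain w where w: "w \<in> swords S" "x = cls w" by (auto simp: carrier_iff)
  have "map snd w \<in> lists S" using w(1) by (induction w) auto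
  with w word_eq_gens[OF w(1)] have "x = elt (map snd w)"
    by (subst w, subst cls_eq_iff) simp_all
  with \<open>map snd w \<in> lists S\<close> show "\<exists>w\<in>lists S. x = elt w" by blast
next
  assume "\<exists>w\<in>lists S. x = elt w"
  then obtain w where "w \<in> lists S" "x = elt w" by blast
  then show "x \<in> carrier P" by (simp only: cls_closed gens_simps)
qed

lemma elt_closed: "w \<in> lists S \<Longrightarrow> elt w \<in> carrier P"
  using carrier_elt by blast

lemma mult_elt:
  "u \<in> lists S \<Longrightarrow> v \<in> lists S \<Longrightarrow> elt u \<otimes>\<^bsub>P\<^esub> elt v = elt (u @ v)"
  by (simp add: mult_cls)

lemma one_elt: "\<one>\<^bsub>P\<^esub> = elt []"
  by (simp add: one_cls)

lemma elt_square: "a \<in> S \<Longrightarrow> u \<in> lists S \<Longrightarrow> v \<in> lists S \<Longrightarrow> elt (u @ a # a # v) = elt (u @ v)"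
  using word_eq_square[of a u v] by (subst cls_eq_iff) auto

lemma elt_rev: "w \<in> lists S \<Longrightarrow> elt (w @ rev w) = \<one>\<^bsub>P\<^esub>"
proof (induction w rule: rev_induct)
  case (snoc a w)
  have "rev w \<in> lists S"
    using snoc.prems by (simp add: in_lists_conv_set)
  with snoc show ?case using elt_square[of a w "rev w"] by simp
qed (simp add: one_elt)

lemma inv_elt:
  assumes "w \<in> lists S"
  shows "inv\<^bsub>P\<^esub> (elt w) = elt (rev w)"
proof -
  interpret group P by (rule group_P)
  have r: "rev w \<in> lists S" using assms by auto
  show ?thesis
    using elt_rev[OF r] assms r by (intro inv_equality elt_closed) (simp_all only: mult_elt rev_rev_ident)
qed

lemma elt_pow:
  assumes "w \<in> lists S"
  shows "elt w [^]\<^bsub>P\<^esub> (k::nat) = elt (concat (replicate k w))"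
proof -
  interpret group P by (rule group_P)
  have "concat (replicate k w) \<in> lists S" for k using assms by (induction k) auto
  then show ?thesis
    using assms
  proof (induction k)
    case (Suc k)
    have "elt w [^]\<^bsub>P\<^esub> Suc k = elt w \<otimes>\<^bsub>P\<^esub> elt w [^]\<^bsub>P\<^esub> k"
      using assms by (intro nat_pow_Suc2 elt_closed)
    also have "\<dots> = elt (concat (replicate (Suc k) w))"
      using Suc by (simp only: mult_elt replicate_Suc concat.simps)
    finally show ?case .
  qed (simp add: one_elt)
qed

end

section \<open>Quotients of subgroups and even words in involutions\<close>

lemma factor_group_iso_image:
  assumes "group G" "group H" "f \<in> hom G H" "subgroup K G"
  shows "(G\<lparr>carrier := K\<rparr>) Mod {x \<in> K. f x = \<one>\<^bsub>H\<^esub>} \<cong> H\<lparr>carrier := f ` K\<rparr>"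
proof -
  interpret group_hom G H f
    using assms by (simp add: group_hom_def group_hom_axioms_def)
  have "subgroup (f ` K) H"
    by (rule subgroup_img_is_subgroup[OF assms(4)])
  then interpret restricted: group_hom "G\<lparr>carrier := K\<rparr>" "H\<lparr>carrier := f ` K\<rparr>" f
    using subgroup.subset[OF assms(4)] assms(4)
    by (auto simp: group_hom_def group_hom_axioms_def hom_def subset_iff
        intro!: G.subgroup_imp_group H.subgroup_imp_group)
  have "kernel (G\<lparr>carrier := K\<rparr>) (H\<lparr>carrier := f ` K\<rparr>) f = {x \<in> K. f x = \<one>\<^bsub>H\<^esub>}"
    by (simp add: kernel_def)
  then show ?thesis
    using restricted.FactGroup_iso by simp
qed

text \<open>
  If \<open>x\<close> has order dividing \<open>p\<close>, then raising to a power \<open>m\<close> prime to \<open>p\<close> permutes the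
  powers of \<open>x\<close>; here \<open>k\<close> is an inverse of \<open>m\<close> modulo \<open>p\<close>.
\<close>

lemma (in group) power_of_coprime_power:
  fixes p m :: nat
  assumes x: "x \<in> carrier G" and "x [^] p = \<one>" "coprime p m"
  obtains k :: nat where "x = (x [^] m) [^] k"
proof -
  obtain k where "[m * k = Suc 0] (mod p)"
    using cong_solve_coprime_nat[of m p] assms(3) by (auto simp: coprime_commute)
  then obtain q1 q2 where "Suc 0 + q1 * p = m * k + q2 * p"
    unfolding cong_iff_lin_nat by blast
  then have "x [^] (Suc 0 + p * q1) = x [^] (m * k + p * q2)"
    by (simp only: mult.commute)
  then have "(x [^] p) [^] q1 \<otimes> x = x [^] (m * k) \<otimes> (x [^] p) [^] q2"
    using x by (simp add: nat_pow_mult[symmetric] nat_pow_pow)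
  then show ?thesis
    using that[of k] assms by (simp add: nat_pow_pow)
qed

text \<open>
  A telescoping argument: with involutions, \<open>g\<^sub>i g\<^sub>j\<close> is the product of the neighbours
  \<open>g\<^sub>k g\<^bsub>k + 1\<^esub>\<close> for \<open>i \<le> k < j\<close>.
\<close>

lemma (in group) products_of_two_involutions_in_subgroup:
  fixes g :: "nat \<Rightarrow> 'a" and N :: nat
  assumes D: "subgroup D G"
    and g: "\<And>i. i \<in> {1..N} \<Longrightarrow> g i \<in> carrier G" "\<And>i. i \<in> {1..N} \<Longrightarrow> g i \<otimes> g i = \<one>"
    and neighbours: "\<And>i. i \<in> {1..N} \<Longrightarrow> Suc i \<in> {1..N} \<Longrightarrow> g i \<otimes> g (Suc i) \<in> D"
    and ij: "i \<in> {1..N}" "j \<in> {1..N}"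
  shows "g i \<otimes> g j \<in> D"
proof -
  have le: "g i \<otimes> g j \<in> D" if "i \<le> j" "i \<in> {1..N}" "j \<in> {1..N}" for i j
    using that
  proof (induction j rule: dec_induct)
    case base
    then show ?case using g subgroup.one_closed[OF D] by simp
  next
    case (step j)
    have j: "j \<in> {1..N}" using step by auto
    have "g j \<otimes> (g j \<otimes> g (Suc j)) = g (Suc j)"
      using g(1)[OF j] g(1)[of "Suc j"] g(2)[OF j] step.prems by (simp add: m_assoc[symmetric])
    then have "g i \<otimes> g (Suc j) = (g i \<otimes> g j) \<otimes> (g j \<otimes> g (Suc j))"
      using g(1)[of i] g(1)[of "Suc j"] g(1)[OF j] step.prems by (simp add: m_assoc)
    also have "\<dots> \<in> D"
      using step j neighbours[of j] by (simp add: subgroup.m_closed[OF D])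
    finally show ?case .
  qed
  show ?thesis
  proof (cases "i \<le> j")
    case True
    then show ?thesis using le ij by simp
  next
    case False
    have "inv (g j \<otimes> g i) \<in> D"
      using False ij le by (intro subgroup.m_inv_closed[OF D]) auto
    moreover have "inv (g k) = g k" if "k \<in> {1..N}" for k
      using that g by (intro inv_equality) auto
    ultimately show ?thesis
      using ij g by (simp add: inv_mult_group)
  qed
qed

section \<open>The twin group and its Tits representation\<close>

lemma involutive_presentation_twin: "involutive_presentation {1..n-1} (twin_relations n)"
  by unfold_locales (auto simp: twin_relations_def)

interpretation twin: involutive_presentation "{1..n-1}" "twin_relations n" for n
  by (rule involutive_presentation_twin)

abbreviation tw :: "nat \<Rightarrow> nat list \<Rightarrow> nat sword set" where
  "tw n w \<equiv> word_class {1..n-1} (twin_relations n) (gens w)"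

lemma group_twin: "group (twin_group n)"
  unfolding twin_group_def by (rule twin.group_P)

lemma carrier_twin: "x \<in> carrier (twin_group n) \<longleftrightarrow> (\<exists>w\<in>lists {1..n-1}. x = tw n w)"
  unfolding twin_group_def by (rule twin.carrier_elt)

lemmas mult_twin = twin.mult_elt[folded twin_group_def]
lemmas tw_closed = twin.elt_closed[folded twin_group_def]
lemmas tw_pow = twin.elt_pow[folded twin_group_def]
lemmas one_twin = twin.one_elt[folded twin_group_def]

lemma hom_from_twin:
  assumes "group H"
    and "\<And>i. i \<in> {1..n-1} \<Longrightarrow> f i \<in> carrier H"
    and "\<And>i. i \<in> {1..n-1} \<Longrightarrow> f i \<otimes>\<^bsub>H\<^esub> f i = \<one>\<^bsub>H\<^esub>"
    and "\<And>i j. i \<in> {1..n-1} \<Longrightarrow> j \<in> {1..n-1} \<Longrightarrow> \<bar>int i - int j\<bar> \<ge> 2 \<Longrightarrow>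
      f i \<otimes>\<^bsub>H\<^esub> f j = f j \<otimes>\<^bsub>H\<^esub> f i"
  shows "induced_hom H f \<in> hom (twin_group n) H"
    and "w \<in> lists {1..n-1} \<Longrightarrow> induced_hom H f (tw n w) = word_value H f (gens w)"
proof -
  interpret H: group H by fact
  have rel: "word_value H f l = word_value H f r" if "(l, r) \<in> twin_relations n" for l r
    using that assms(2-4) by (auto simp: twin_relations_def)
  show "induced_hom H f \<in> hom (twin_group n) H"
    unfolding twin_group_def by (rule twin.induced_hom_hom) (use assms rel in auto)
  show "w \<in> lists {1..n-1} \<Longrightarrow> induced_hom H f (tw n w) = word_value H f (gens w)"
    by (rule twin.induced_hom_cls[OF assms(1)]) (use assms rel in auto)
qed

text \<open>
  The entries of the Tits matrix of a word, with rows and columns numbered from \<open>1\<close>. The rows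
  \<open>0\<close> and \<open>n\<close> are defined as well and vanish, so that multiplication by a generator needs no
  case distinction at the boundary.
\<close>

fun tits_word :: "nat \<Rightarrow> nat list \<Rightarrow> nat \<Rightarrow> nat \<Rightarrow> int" where
  "tits_word n [] r c = (if r = c \<and> r \<in> {1..n-1} then 1 else 0)"
| "tits_word n (i # w) r c =
     (if r = i then 2 * tits_word n w (i - 1) c - tits_word n w i c + 2 * tits_word n w (i + 1) c
      else tits_word n w r c)"

lemma tits_word_boundary:
  assumes "w \<in> lists {1..n-1}" "r = 0 \<or> r \<ge> n"
  shows "tits_word n w r c = 0"
  using assms by (induction w) auto

definition tits_word_mat :: "nat \<Rightarrow> nat list \<Rightarrow> int mat" where
  "tits_word_mat n w = mat (n - 1) (n - 1) (\<lambda>(r, c). tits_word n w (r + 1) (c + 1))"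

lemma tits_word_mat_carrier [simp]: "tits_word_mat n w \<in> carrier_mat (n - 1) (n - 1)"
  by (simp add: tits_word_mat_def)

lemma tits_mat_carrier [simp]: "tits_mat n i \<in> carrier_mat (n - 1) (n - 1)"
  by (simp add: tits_mat_def)

lemma tits_word_mat_Nil: "tits_word_mat n [] = 1\<^sub>m (n - 1)"
  by (rule eq_matI) (auto simp: tits_word_mat_def)

text \<open>
  Row \<open>i\<close> of \<open>X\<^sub>i\<close> has at most three nonzero entries; where one of its neighbours is missing, the
  vanishing boundary row of \<^const>\<open>tits_word\<close> stands in for it.
\<close>

lemma tits_word_mat_Cons:
  assumes i: "i \<in> {1..n-1}" and w: "w \<in> lists {1..n-1}"
  shows "tits_mat n i * tits_word_mat n w = tits_word_mat n (i # w)"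
proof (rule eq_matI)
  fix r c
  assume "r < dim_row (tits_word_mat n (i # w))" "c < dim_col (tits_word_mat n (i # w))"
  then have rc: "r < n - 1" "c < n - 1"
    by (simp_all add: tits_word_mat_def)
  have "(tits_mat n i * tits_word_mat n w) $$ (r, c) =
      (\<Sum>k<n-1. tits_entry i (r + 1) (k + 1) * tits_word n w (k + 1) (c + 1))"
    using rc by (simp add: tits_mat_def tits_word_mat_def scalar_prod_def lessThan_atLeast0)
  also have "\<dots> = tits_word n (i # w) (r + 1) (c + 1)"
  proof (cases "r + 1 = i")
    case False
    then have "(\<Sum>k<n-1. tits_entry i (r + 1) (k + 1) * tits_word n w (k + 1) (c + 1)) =
        (\<Sum>k<n-1. if k = r then tits_word n w (k + 1) (c + 1) else 0)"
      by (intro sum.cong HOL.refl) (auto simp: tits_entry_def)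
    also have "\<dots> = tits_word n w (r + 1) (c + 1)"
      using rc by (simp only: sum.delta finite_lessThan lessThan_iff if_True)
    finally show ?thesis using False by simp
  next
    case True
    \<comment> \<open>Matrix indices start at \<open>0\<close>: row \<open>k\<close> of the matrix is row \<open>k + 1\<close> of
      \<^const>\<open>tits_word\<close>.\<close>
    define e where "e k = tits_word n w (k + 1) (c + 1)" for k
    obtain j where j: "i = Suc j" "j < n - 1"
      using i by (cases i) auto
    have "(\<Sum>k<n-1. tits_entry i i (k + 1) * e k) =
        (\<Sum>k<n-1. (if k = j then - e k else 0) + (if k = Suc j then 2 * e k else 0) +
          (if Suc k = j then 2 * e k else 0))"
      by (intro sum.cong HOL.refl) (auto simp: tits_entry_def j)
    also have "\<dots> = (\<Sum>k<n-1. if k = j then - e k else 0) +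
        (\<Sum>k<n-1. if k = Suc j then 2 * e k else 0) + (\<Sum>k<n-1. if Suc k = j then 2 * e k else 0)"
      by (simp only: sum.distrib)
    also have "(\<Sum>k<n-1. if k = j then - e k else 0) = - e j"
      using j by (simp only: sum.delta finite_lessThan lessThan_iff if_True)
    also have "(\<Sum>k<n-1. if k = Suc j then 2 * e k else 0) = 2 * tits_word n w (i + 1) (c + 1)"
      using j tits_word_boundary[OF w, of "i + 1" "c + 1"]
      by (cases "Suc j < n - 1") (simp_all add: e_def)
    also have "(\<Sum>k<n-1. if Suc k = j then 2 * e k else 0) = 2 * tits_word n w (i - 1) (c + 1)"
      using j tits_word_boundary[OF w, of 0 "c + 1"] by (cases j) (simp_all add: e_def)
    also have "- e j + 2 * tits_word n w (i + 1) (c + 1) + 2 * tits_word n w (i - 1) (c + 1) =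
        tits_word n (i # w) i (c + 1)"
      using j by (simp add: e_def)
    finally show ?thesis using True by (simp add: e_def)
  qed
  finally show "(tits_mat n i * tits_word_mat n w) $$ (r, c) = tits_word_mat n (i # w) $$ (r, c)"
    using rc by (simp add: tits_word_mat_def)
qed (simp_all add: tits_mat_def tits_word_mat_def)

lemma tits_mat_eq: "i \<in> {1..n-1} \<Longrightarrow> tits_mat n i = tits_word_mat n [i]"
  using tits_word_mat_Cons[of i n "[]"] right_mult_one_mat[OF tits_mat_carrier[of n i]]
  by (simp add: tits_word_mat_Nil)

lemma tits_mat_mult:
  "i \<in> {1..n-1} \<Longrightarrow> j \<in> {1..n-1} \<Longrightarrow> tits_mat n i * tits_mat n j = tits_word_mat n [i, j]"
  by (simp add: tits_mat_eq[of j] tits_word_mat_Cons)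

lemma tits_mat_square:
  assumes i: "i \<in> {1..n-1}"
  shows "tits_mat n i * tits_mat n i = 1\<^sub>m (n - 1)"
proof -
  have "i - 1 \<noteq> i" "i + 1 \<noteq> i" using i by auto
  then have "tits_word n [i, i] r c = tits_word n [] r c" for r c
    by (simp only: tits_word.simps(2) if_True if_False split: if_split) simp
  then show ?thesis
    unfolding tits_mat_mult[OF i i] tits_word_mat_Nil[symmetric] tits_word_mat_def by (simp only:)
qed

lemma tits_mat_commute:
  assumes i: "i \<in> {1..n-1}" and j: "j \<in> {1..n-1}" and ij: "\<bar>int i - int j\<bar> \<ge> 2"
  shows "tits_mat n i * tits_mat n j = tits_mat n j * tits_mat n i"
proof -
  have "i - 1 \<noteq> j" "i + 1 \<noteq> j" "j - 1 \<noteq> i" "j + 1 \<noteq> i" "i \<noteq> j" "j \<noteq> i"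
    using i j ij by auto
  then have "tits_word n [i, j] r c = tits_word n [j, i] r c" for r c
    by (cases "r = i"; cases "r = j") (simp_all only: tits_word.simps(2) if_False if_True simp_thms)
  then show ?thesis
    unfolding tits_mat_mult[OF i j] tits_mat_mult[OF j i] tits_word_mat_def by (simp only:)
qed

lemma group_GL_int: "group (GL_int k)"
proof -
  interpret semiring "ring_mat TYPE(int) k ()" by (rule semiring_mat)
  show ?thesis unfolding GL_int_def by (rule units_group)
qed

lemma GL_int_simps:
  "mult (GL_int k) = (*)" "\<one>\<^bsub>GL_int k\<^esub> = 1\<^sub>m k"
  "A \<in> carrier (GL_int k) \<longleftrightarrow>
    A \<in> carrier_mat k k \<and> (\<exists>B\<in>carrier_mat k k. B * A = 1\<^sub>m k \<and> A * B = 1\<^sub>m k)"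
  by (auto simp: GL_int_def units_of_def Units_def ring_mat_simps)

lemma tits_mat_closed: "i \<in> {1..n-1} \<Longrightarrow> tits_mat n i \<in> carrier (GL_int (n - 1))"
  using tits_mat_square[of i n] tits_mat_carrier[of n i] unfolding GL_int_simps by blast

lemma tits_rep_hom: "tits_rep n \<in> hom (twin_group n) (GL_int (n - 1))"
  unfolding tits_rep_def using tits_mat_square tits_mat_commute
  by (intro hom_from_twin(1)[OF group_GL_int tits_mat_closed]) (simp_all only: GL_int_simps)

lemma tits_rep_tw:
  assumes "w \<in> lists {1..n-1}"
  shows "tits_rep n (tw n w) = tits_word_mat n w"
proof -
  have "tits_rep n (tw n w) = word_value (GL_int (n - 1)) (tits_mat n) (gens w)"
    unfolding tits_rep_def using tits_mat_square tits_mat_commute assms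
    by (intro hom_from_twin(2)[OF group_GL_int tits_mat_closed]) (simp_all only: GL_int_simps)
  also have "\<dots> = tits_word_mat n w"
    using assms
  proof (induction w)
    case (Cons i w)
    then show ?case
      by (simp add: GL_int_simps tits_word_mat_Cons del: One_nat_def)
  qed (simp add: GL_int_simps tits_word_mat_Nil)
  finally show ?thesis .
qed

section \<open>Principal congruence subgroups\<close>

lemma reduce_mat_mult_cong:
  assumes "A \<in> carrier_mat k k" "A' \<in> carrier_mat k k" "B \<in> carrier_mat k k" "B' \<in> carrier_mat k k"
    and "reduce_mat m A = reduce_mat m A'" "reduce_mat m B = reduce_mat m B'"
  shows "reduce_mat m (A * B) = reduce_mat m (A' * B')"
proof -
  have entry: "[M $$ (r, c) = M' $$ (r, c)] (mod int m)"
    if "reduce_mat m M = reduce_mat m M'" "M \<in> carrier_mat k k" "M' \<in> carrier_mat k k" "r < k" "c < k"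
    for M M' r c
  proof -
    have "reduce_mat m M $$ (r, c) = reduce_mat m M' $$ (r, c)"
      by (simp only: that(1))
    with that(2-5) show ?thesis by (simp add: reduce_mat_def cong_def)
  qed
  show ?thesis
  proof (rule eq_matI)
    fix r c
    assume "r < dim_row (reduce_mat m (A' * B'))" "c < dim_col (reduce_mat m (A' * B'))"
    then have rc: "r < k" "c < k" using assms(1-4) by (simp_all add: reduce_mat_def)
    have "[(\<Sum>i\<in>{0..<k}. A $$ (r, i) * B $$ (i, c)) = (\<Sum>i\<in>{0..<k}. A' $$ (r, i) * B' $$ (i, c))] (mod int m)"
      using entry[OF assms(5,1,2)] entry[OF assms(6,3,4)] rc
      by (intro cong_sum cong_mult) simp_all
    then show "reduce_mat m (A * B) $$ (r, c) = reduce_mat m (A' * B') $$ (r, c)"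
      using rc assms(1-4) by (simp add: reduce_mat_def scalar_prod_def cong_def)
  qed (use assms(1-4) in \<open>simp_all add: reduce_mat_def\<close>)
qed

lemma congruence_subgroup_eq:
  "congruence_subgroup n m =
    {x \<in> carrier (twin_group n). reduce_mat m (tits_rep n x) = reduce_mat m (1\<^sub>m (n - 1))}"
  by (simp add: congruence_subgroup_def kernel_def GL_mod_def units_of_def mat_mod_def)

lemma subgroup_congruence_subgroup: "subgroup (congruence_subgroup n m) (twin_group n)"
proof -
  interpret T: group "twin_group n" by (rule group_twin)
  interpret rep: group_hom "twin_group n" "GL_int (n - 1)" "tits_rep n"
    using tits_rep_hom group_GL_int group_twin by (simp add: group_hom_def group_hom_axioms_def)
  have carr: "tits_rep n x \<in> carrier_mat (n - 1) (n - 1)" if "x \<in> carrier (twin_group n)" for x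
    using rep.hom_closed[OF that] by (simp only: GL_int_simps)
  let ?I = "1\<^sub>m (n - 1) :: int mat"
  show ?thesis
  proof (rule T.subgroupI)
    show "congruence_subgroup n m \<subseteq> carrier (twin_group n)"
      by (auto simp: congruence_subgroup_eq)
    have "\<one>\<^bsub>twin_group n\<^esub> \<in> congruence_subgroup n m"
      using rep.hom_one T.one_closed by (simp only: congruence_subgroup_eq GL_int_simps mem_Collect_eq simp_thms)
    then show "congruence_subgroup n m \<noteq> {}" by blast
  next
    fix x
    assume "x \<in> congruence_subgroup n m"
    then have x: "x \<in> carrier (twin_group n)" "reduce_mat m (tits_rep n x) = reduce_mat m ?I"
      by (simp_all add: congruence_subgroup_eq)
    have y: "inv\<^bsub>twin_group n\<^esub> x \<in> carrier (twin_group n)"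
      using x by simp
    have "tits_rep n (inv\<^bsub>twin_group n\<^esub> x) * tits_rep n x = ?I"
      using rep.hom_mult[OF y x(1)] rep.hom_one T.l_inv[OF x(1)] by (simp only: GL_int_simps)
    then have "reduce_mat m ?I = reduce_mat m (tits_rep n (inv\<^bsub>twin_group n\<^esub> x) * ?I)"
      using reduce_mat_mult_cong[OF carr[OF y] carr[OF y] carr[OF x(1)] one_carrier_mat HOL.refl x(2)]
      by (simp only:)
    then have "reduce_mat m (tits_rep n (inv\<^bsub>twin_group n\<^esub> x)) = reduce_mat m ?I"
      by (simp only: right_mult_one_mat[OF carr[OF y]])
    with y show "inv\<^bsub>twin_group n\<^esub> x \<in> congruence_subgroup n m"
      by (simp only: congruence_subgroup_eq mem_Collect_eq simp_thms)
  next
    fix x y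
    assume "x \<in> congruence_subgroup n m" "y \<in> congruence_subgroup n m"
    then have x: "x \<in> carrier (twin_group n)" "reduce_mat m (tits_rep n x) = reduce_mat m ?I"
      and y: "y \<in> carrier (twin_group n)" "reduce_mat m (tits_rep n y) = reduce_mat m ?I"
      by (simp_all add: congruence_subgroup_eq)
    have "reduce_mat m (tits_rep n x * tits_rep n y) = reduce_mat m (?I * ?I)"
      by (rule reduce_mat_mult_cong[OF carr[OF x(1)] one_carrier_mat carr[OF y(1)] one_carrier_mat x(2) y(2)])
    then have "reduce_mat m (tits_rep n (x \<otimes>\<^bsub>twin_group n\<^esub> y)) = reduce_mat m ?I"
      by (simp only: rep.hom_mult[OF x(1) y(1)] GL_int_simps right_mult_one_mat[OF one_carrier_mat])
    with T.m_closed[OF x(1) y(1)] show "x \<otimes>\<^bsub>twin_group n\<^esub> y \<in> congruence_subgroup n m"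
      by (simp only: congruence_subgroup_eq mem_Collect_eq simp_thms)
  qed
qed

lemma tw_mem_congruence_subgroup_iff:
  assumes "w \<in> lists {1..n-1}"
  shows "tw n w \<in> congruence_subgroup n m \<longleftrightarrow>
    (\<forall>r\<in>{1..n-1}. \<forall>c\<in>{1..n-1}. [tits_word n w r c = tits_word n [] r c] (mod int m))"
    (is "_ \<longleftrightarrow> ?R")
proof -
  have "tw n w \<in> congruence_subgroup n m \<longleftrightarrow>
      reduce_mat m (tits_word_mat n w) = reduce_mat m (tits_word_mat n [])"
    using tw_closed[OF assms]
    by (simp only: congruence_subgroup_eq mem_Collect_eq simp_thms tits_rep_tw[OF assms] tits_word_mat_Nil)
  also have "\<dots> \<longleftrightarrow> (\<forall>r<n-1. \<forall>c<n-1.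
      [tits_word n w (Suc r) (Suc c) = tits_word n [] (Suc r) (Suc c)] (mod int m))"
    by (simp add: mat_eq_iff reduce_mat_def tits_word_mat_def cong_def del: tits_word.simps One_nat_def
        flip: Suc_eq_plus1)
  also have "\<dots> \<longleftrightarrow> ?R"
  proof
    assume *: "\<forall>r<n-1. \<forall>c<n-1.
      [tits_word n w (Suc r) (Suc c) = tits_word n [] (Suc r) (Suc c)] (mod int m)"
    show ?R
    proof (intro ballI)
      fix r c
      assume "r \<in> {1..n-1}" "c \<in> {1..n-1}"
      then have "r - 1 < n - 1" "c - 1 < n - 1" and Suc: "Suc (r - 1) = r" "Suc (c - 1) = c"
        by auto
      then show "[tits_word n w r c = tits_word n [] r c] (mod int m)"
        using *[rule_format, of "r - 1" "c - 1"] by (simp only: Suc)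
    qed
  next
    assume ?R
    then show "\<forall>r<n-1. \<forall>c<n-1.
      [tits_word n w (Suc r) (Suc c) = tits_word n [] (Suc r) (Suc c)] (mod int m)"
      by (simp del: tits_word.simps)
  qed
  finally show ?thesis .
qed

lemma congruence_subgroup_mono:
  assumes "k dvd m"
  shows "congruence_subgroup n m \<subseteq> congruence_subgroup n k"
proof
  fix x
  assume x: "x \<in> congruence_subgroup n m"
  then obtain w where w: "w \<in> lists {1..n-1}" "x = tw n w"
    unfolding congruence_subgroup_eq carrier_twin by blast
  from x assms show "x \<in> congruence_subgroup n k"
    unfolding w(2) tw_mem_congruence_subgroup_iff[OF w(1)]
    by (meson cong_dvd_modulus int_dvd_int_iff)
qed

lemma congruence_subgroup_coprime:
  assumes "coprime k m"
  shows "congruence_subgroup n (k * m) = congruence_subgroup n k \<inter> congruence_subgroup n m"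
proof
  show "congruence_subgroup n (k * m) \<subseteq> congruence_subgroup n k \<inter> congruence_subgroup n m"
    by (simp add: congruence_subgroup_mono)
  show "congruence_subgroup n k \<inter> congruence_subgroup n m \<subseteq> congruence_subgroup n (k * m)"
  proof
    fix x
    assume x: "x \<in> congruence_subgroup n k \<inter> congruence_subgroup n m"
    then obtain w where w: "w \<in> lists {1..n-1}" "x = tw n w"
      unfolding congruence_subgroup_eq carrier_twin by blast
    have "coprime (int k) (int m)" using assms by simp
    with x show "x \<in> congruence_subgroup n (k * m)"
      unfolding w(2) Int_iff tw_mem_congruence_subgroup_iff[OF w(1)] of_nat_mult
      by (meson coprime_cong_mult)
  qed
qed

subsection \<open>Elements of the congruence subgroups have even length\<close>

text \<open>
  \<open>X\<^sub>i\<close> arises from the identity by negating row \<open>i\<close> and then adding multiples of the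
  neighbouring rows to it.
\<close>

lemma det_tits_mat:
  assumes i: "i \<in> {1..n-1}"
  shows "det (tits_mat n i) = -1"
proof -
  obtain j where j: "i = Suc j" "j < n - 1" using i by (cases i) auto
  define A where "A = multrow j (-1) (1\<^sub>m (n - 1) :: int mat)"
  define B where "B = (if j = 0 then A else addrow 2 j (j - 1) A)"
  define C where "C = (if Suc j < n - 1 then addrow 2 j (Suc j) B else B)"
  have A: "A \<in> carrier_mat (n - 1) (n - 1)" by (simp add: A_def)
  then have B: "B \<in> carrier_mat (n - 1) (n - 1)" by (simp add: B_def)
  then have C: "C \<in> carrier_mat (n - 1) (n - 1)" by (simp add: C_def)
  have "tits_mat n i = C"
  proof (rule eq_matI)
    fix r c
    assume "r < dim_row C" "c < dim_col C"
    then have rc: "r < n - 1" "c < n - 1"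
      using C by auto
    have "A $$ (r, c) = (if r = c then if r = j then -1 else 1 else 0)"
      using rc unfolding A_def by simp
    moreover have "B $$ (r, c) = (if r = j \<and> Suc c = j then 2 else A $$ (r, c))"
    proof (cases "j = 0")
      case False
      have "A $$ (j - 1, c) = (if Suc c = j then 1 else 0)"
        using rc j(2) False unfolding A_def by auto
      then show ?thesis
        using rc A False unfolding B_def A_def by auto
    qed (simp add: B_def)
    moreover have "C $$ (r, c) = (if r = j \<and> c = Suc j then 2 else B $$ (r, c))"
    proof (cases "Suc j < n - 1")
      case True
      have "B $$ (Suc j, c) = A $$ (Suc j, c)"
        using rc True A unfolding B_def by auto
      also have "\<dots> = (if c = Suc j then 1 else 0)"
        using rc True unfolding A_def by auto
      finally have "B $$ (Suc j, c) = (if c = Suc j then 1 else 0)" .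
      moreover have "B $$ (j, Suc j) = 0"
        using True A unfolding B_def A_def by auto
      ultimately show ?thesis
        using rc B True unfolding C_def by auto
    qed (use rc in \<open>auto simp: C_def\<close>)
    ultimately show "tits_mat n i $$ (r, c) = C $$ (r, c)"
      using rc by (auto simp: tits_mat_def tits_entry_def j(1))
  qed (use C in \<open>auto simp: tits_mat_def\<close>)
  moreover have "det A = -1"
    unfolding A_def using det_multrow[OF j(2) one_carrier_mat] by simp
  moreover have "det B = det A"
    unfolding B_def using det_addrow[OF _ _ A, of "j - 1" j 2] j(2) by simp
  moreover have "det C = det B"
    unfolding C_def using det_addrow[OF _ _ B, of "Suc j" j 2] j(2) by simp
  ultimately show ?thesis by simp
qed

lemma det_tits_word_mat: "w \<in> lists {1..n-1} \<Longrightarrow> det (tits_word_mat n w) = (-1) ^ length w"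
proof (induction w)
  case Nil
  then show ?case by (simp add: tits_word_mat_Nil)
next
  case (Cons i w)
  then show ?case
    using det_mult[OF tits_mat_carrier tits_word_mat_carrier, of n i w] det_tits_mat[of i n]
    by (simp add: tits_word_mat_Cons del: One_nat_def)
qed

text \<open>
  Modulo \<open>m \<ge> 3\<close> the determinant still separates \<open>1\<close> from \<open>-1\<close>, hence detects the parity
  of the length.
\<close>

lemma even_length_if_congruence_subgroup:
  assumes m: "m \<ge> 3" and w: "w \<in> lists {1..n-1}" and mem: "tw n w \<in> congruence_subgroup n m"
  shows "even (length w)"
proof -
  have "[det (tits_word_mat n w) = det (tits_word_mat n [])] (mod int m)"
    unfolding det_def'[OF tits_word_mat_carrier]
  proof (intro cong_sum cong_mult cong_prod cong_refl)
    fix p i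
    assume "p \<in> {p. p permutes {0..<n - 1}}" "i \<in> {0..<n - 1}"
    then have less: "i < n - 1" "p i < n - 1"
      using permutes_in_image[of p "{0..<n - 1}" i] by auto
    then have "i + 1 \<in> {1..n-1}" "p i + 1 \<in> {1..n-1}"
      by auto
    with mem have "[tits_word n w (i + 1) (p i + 1) = tits_word n [] (i + 1) (p i + 1)] (mod int m)"
      unfolding tw_mem_congruence_subgroup_iff[OF w] by blast
    with less show "[tits_word_mat n w $$ (i, p i) = tits_word_mat n [] $$ (i, p i)] (mod int m)"
      by (simp only: tits_word_mat_def index_mat split_conv)
  qed
  then have cong: "[(-1) ^ length w = (1::int)] (mod int m)"
    using det_tits_word_mat[OF w] by (simp add: tits_word_mat_Nil)
  show ?thesis
  proof (rule ccontr)
    assume "odd (length w)"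
    with cong have "int m dvd 2"
      by (simp add: cong_iff_dvd_diff)
    with m show False using zdvd_imp_le[of "int m" 2] by simp
  qed
qed

subsection \<open>Powers of products of neighbouring generators\<close>

text \<open>
  The matrix \<open>X\<^sub>i X\<^bsub>i + 1\<^esub>\<close> is \<open>1 + N\<close> with \<open>N ^ 3 = 0\<close>, so its \<open>k\<close>-th power is
  \<open>1 + k N + (k (k - 1) / 2) N\<^sup>2\<close>. As \<open>N\<close> is even, \<open>N\<^sup>2\<close> is divisible by \<open>4\<close>, and the denominator
  does no harm: the power is congruent to \<open>1\<close> modulo \<open>k\<close>, also for even \<open>k\<close>.
\<close>

lemma dvd_tits_word_neighbour_power:
  assumes i: "i \<in> {1..n-1}" "i + 1 \<in> {1..n-1}" and c: "c \<in> {1..n-1}"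
  shows "int k dvd tits_word n (concat (replicate k [i, i + 1])) r c - tits_word n [] r c"
proof -
  \<comment> \<open>Only the rows \<open>i\<close> and \<open>i + 1\<close> of \<open>N\<close> and \<open>N\<^sup>2\<close> are nonzero, and these two rows of \<open>N\<^sup>2\<close> agree.
    In column \<open>c\<close>, \<open>d\<close> is the identity matrix, \<open>N r\<close> a nonzero row of \<open>N\<close>, and \<open>e k\<close> the
    contribution of \<open>N\<^sup>2\<close>. The terms \<open>d 0\<close> and \<open>d n\<close> that occur at the boundary vanish.\<close>
  define d where "d j = (if j = c then 1 else (0::int))" for j
  define e where "e k = 2 * int k * (int k - 1) * (d (i - 1) + d (i + 2))" for k
  define N where "N r = (if r = i then 2 * d (i - 1) + 2 * d i - 2 * d (i + 1) + 4 * d (i + 2)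
    else 2 * d i - 2 * d (i + 1) + 2 * d (i + 2))" for r
  have power: "tits_word n (concat (replicate k [i, i + 1])) r c =
      d r + (if r = i \<or> r = i + 1 then int k * N r + e k else 0)" for r
  proof (induction k arbitrary: r)
    case 0
    then show ?case using c by (auto simp: d_def e_def)
  next
    case (Suc k)
    define W where "W r = tits_word n (concat (replicate k [i, i + 1])) r c" for r
    have W: "W i = d i + int k * N i + e k" "W (i + 1) = d (i + 1) + int k * N (i + 1) + e k"
      "W (i - 1) = d (i - 1)" "W (i + 2) = d (i + 2)"
      unfolding W_def Suc.IH using i by auto
    have index: "i + 1 - 1 = i" "i + 1 + 1 = i + 2" "i - 1 \<noteq> i + 1" "i \<noteq> i + 1"
      using i by simp_all
    have row: "tits_word n (concat (replicate (Suc k) [i, i + 1])) r c =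
        (if r = i then 2 * W (i - 1) - W i + 2 * (2 * W i - W (i + 1) + 2 * W (i + 2))
         else if r = i + 1 then 2 * W i - W (i + 1) + 2 * W (i + 2) else W r)"
      unfolding W_def replicate_Suc concat.simps append.simps tits_word.simps(2)
      by (simp only: index if_True if_False simp_thms)
    have e: "e (Suc k) = e k + 4 * int k * (d (i - 1) + d (i + 2))"
      by (simp add: e_def algebra_simps)
    consider "r = i" | "r = i + 1" | "r \<noteq> i" "r \<noteq> i + 1" by blast
    then show ?case
    proof cases
      case 1
      then show ?thesis unfolding row W e by (simp add: N_def algebra_simps)
    next
      case 2
      then show ?thesis unfolding row W e by (simp add: N_def algebra_simps)
    next
      case 3
      then have "W r = d r" unfolding W_def Suc.IH by simp
      with 3 show ?thesis unfolding row by simp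
    qed
  qed
  have "tits_word n [] r c = d r"
    using c by (auto simp: d_def)
  then have "tits_word n (concat (replicate k [i, i + 1])) r c - tits_word n [] r c =
      int k * (if r = i \<or> r = i + 1 then N r + 2 * (int k - 1) * (d (i - 1) + d (i + 2)) else 0)"
    unfolding power e_def by (simp add: algebra_simps)
  then show ?thesis by (simp only: dvd_triv_left)
qed

lemma neighbour_power_in_congruence_subgroup:
  assumes i: "i \<in> {1..n-1}" "i + 1 \<in> {1..n-1}"
  shows "tw n [i, i + 1] [^]\<^bsub>twin_group n\<^esub> m \<in> congruence_subgroup n m"
proof -
  have 2: "[i, i + 1] \<in> lists {1..n-1}" using i by simp
  have w: "concat (replicate m [i, i + 1]) \<in> lists {1..n-1}"
    using 2 by (induction m) simp_all
  show ?thesis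
    unfolding tw_pow[OF 2] tw_mem_congruence_subgroup_iff[OF w] cong_iff_dvd_diff
    using dvd_tits_word_neighbour_power[OF i] by blast
qed

text \<open>
  The determinant shows that level \<open>m\<close> contains only even words. Conversely, by telescoping it is
  enough to reach the images of the \<open>s\<^sub>i s\<^bsub>i + 1\<^esub>\<close>; as \<open>p\<close> is prime to \<open>m\<close>, these are powers of
  their own \<open>m\<close>-th powers, which come from level \<open>m\<close>.
\<close>

lemma image_congruence_subgroup_eq_even_words:
  assumes m: "m \<ge> 3" and H: "group H" and h: "h \<in> hom (twin_group n) H"
    and order: "\<And>i. i \<in> {1..n-1} \<Longrightarrow> i + 1 \<in> {1..n-1} \<Longrightarrow> h (tw n [i, i + 1]) [^]\<^bsub>H\<^esub> p = \<one>\<^bsub>H\<^esub>"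
    and p: "coprime p m"
  shows "h ` congruence_subgroup n m = {h (tw n w) | w. w \<in> lists {1..n-1} \<and> even (length w)}"
proof -
  interpret group_hom "twin_group n" H h
    using group_twin H h by (simp add: group_hom_def group_hom_axioms_def)
  define D where "D = h ` congruence_subgroup n m"
  have D: "subgroup D H"
    unfolding D_def by (rule subgroup_img_is_subgroup[OF subgroup_congruence_subgroup])
  define g where "g i = h (tw n [i])" for i
  have h_append: "h (tw n (u @ v)) = h (tw n u) \<otimes>\<^bsub>H\<^esub> h (tw n v)"
    if "u \<in> lists {1..n-1}" "v \<in> lists {1..n-1}" for u v
    using hom_mult[OF tw_closed[OF that(1)] tw_closed[OF that(2)]] mult_twin[OF that] by (simp only:)
  have h_two: "h (tw n [i, j]) = g i \<otimes>\<^bsub>H\<^esub> g j" if "i \<in> {1..n-1}" "j \<in> {1..n-1}" for i j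
    using h_append[of "[i]" "[j]"] that unfolding g_def by simp
  have g: "g i \<in> carrier H" if "i \<in> {1..n-1}" for i
    unfolding g_def using that by (intro hom_closed tw_closed) simp
  have g2: "g i \<otimes>\<^bsub>H\<^esub> g i = \<one>\<^bsub>H\<^esub>" if "i \<in> {1..n-1}" for i
    using twin.elt_square[OF that, of "[]" "[]"] hom_one h_two[OF that that]
    by (simp add: one_twin)
  have neighbours: "g i \<otimes>\<^bsub>H\<^esub> g (Suc i) \<in> D" if i: "i \<in> {1..n-1}" "Suc i \<in> {1..n-1}" for i
  proof -
    have i': "i + 1 \<in> {1..n-1}" using i by simp
    have tw: "tw n [i, i + 1] \<in> carrier (twin_group n)"
      using i i' by (intro tw_closed) simp
    have gg: "g i \<otimes>\<^bsub>H\<^esub> g (Suc i) = h (tw n [i, i + 1])"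
      using h_two[OF i] by simp
    obtain k :: nat where k: "h (tw n [i, i + 1]) = (h (tw n [i, i + 1]) [^]\<^bsub>H\<^esub> m) [^]\<^bsub>H\<^esub> k"
      using H.power_of_coprime_power[OF hom_closed[OF tw] order[OF i(1) i'] p] by metis
    have "h (tw n [i, i + 1]) [^]\<^bsub>H\<^esub> m \<in> D"
      unfolding D_def hom_nat_pow[OF tw, symmetric]
      by (intro imageI neighbour_power_in_congruence_subgroup i(1) i')
    then have "(h (tw n [i, i + 1]) [^]\<^bsub>H\<^esub> m) [^]\<^bsub>H\<^esub> k \<in> D"
      by (induction k) (simp_all add: subgroup.one_closed[OF D] subgroup.m_closed[OF D])
    then show ?thesis
      unfolding gg using k by (simp only:)
  qed
  have "h (tw n w) \<in> D" if "w \<in> lists {1..n-1}" "even (length w)" for w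
    using that
  proof (induction w rule: induct_list012)
    case 1
    then show ?case
      using hom_one subgroup.one_closed[OF D] by (simp add: one_twin)
  next
    case (3 i j w)
    have "h (tw n ([i, j] @ w)) = h (tw n [i, j]) \<otimes>\<^bsub>H\<^esub> h (tw n w)"
      using 3 by (intro h_append) auto
    also have "\<dots> = (g i \<otimes>\<^bsub>H\<^esub> g j) \<otimes>\<^bsub>H\<^esub> h (tw n w)"
      using 3 by (subst h_two) auto
    also have "\<dots> \<in> D"
    proof (rule subgroup.m_closed[OF D])
      show "g i \<otimes>\<^bsub>H\<^esub> g j \<in> D"
        using "3.prems" by (intro H.products_of_two_involutions_in_subgroup[where g = g and N = "n - 1", OF D g g2 neighbours]) auto
      show "h (tw n w) \<in> D" using 3 by auto
    qed
    finally show ?case by simp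
  qed simp
  moreover have "\<exists>w. x = h (tw n w) \<and> w \<in> lists {1..n-1} \<and> even (length w)" if "x \<in> D" for x
  proof -
    obtain y where y: "y \<in> congruence_subgroup n m" "x = h y" using \<open>x \<in> D\<close> unfolding D_def by blast
    then obtain w where w: "w \<in> lists {1..n-1}" "y = tw n w"
      unfolding congruence_subgroup_eq carrier_twin by blast
    with y even_length_if_congruence_subgroup[OF m w(1)] show ?thesis by blast
  qed
  ultimately show ?thesis unfolding D_def[symmetric] by blast
qed

subsection \<open>Quotients as images\<close>

lemma congruence_quotient_iso_image:
  assumes "group H" "h \<in> hom (twin_group n) H" "coprime p m"
    and kernel: "\<And>x. x \<in> carrier (twin_group n) \<Longrightarrow> h x = \<one>\<^bsub>H\<^esub> \<longleftrightarrow> x \<in> congruence_subgroup n p"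
  shows "congruence_quotient n m (p * m) \<cong> H\<lparr>carrier := h ` congruence_subgroup n m\<rparr>"
proof -
  have "congruence_subgroup n m \<subseteq> carrier (twin_group n)"
    by (rule subgroup.subset[OF subgroup_congruence_subgroup])
  then have "{x \<in> congruence_subgroup n m. h x = \<one>\<^bsub>H\<^esub>} = congruence_subgroup n (p * m)"
    using kernel unfolding congruence_subgroup_coprime[OF assms(3)] by blast
  then show ?thesis
    using factor_group_iso_image[OF group_twin assms(1,2) subgroup_congruence_subgroup[of n m]]
    unfolding congruence_quotient_def by (simp only:)
qed

section \<open>Level three and the symmetric group\<close>

primrec word_perm :: "nat list \<Rightarrow> nat \<Rightarrow> nat" where
  "word_perm [] = id"
| "word_perm (i # w) = Transposition.transpose i (i + 1) \<circ> word_perm w"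

definition perm_rep :: "nat \<Rightarrow> nat sword set \<Rightarrow> nat \<Rightarrow> nat" where
  "perm_rep n = induced_hom (sym_group n) (\<lambda>i. Transposition.transpose i (i + 1))"

lemma transpose_neighbours_permutes:
  fixes i n :: nat
  shows "i \<in> {1..n-1} \<Longrightarrow> Transposition.transpose i (i + 1) permutes {1..n}"
  by (rule permutes_swap_id) auto

lemma transpose_neighbours_commute:
  fixes i j :: nat
  assumes "\<bar>int i - int j\<bar> \<ge> 2"
  shows "Transposition.transpose i (i + 1) \<circ> Transposition.transpose j (j + 1) =
    Transposition.transpose j (j + 1) \<circ> Transposition.transpose i (i + 1)"
proof -
  have "i \<noteq> j" "i + 1 \<noteq> j" "i \<noteq> j + 1" using assms by auto
  then show ?thesis by (auto simp: fun_eq_iff Transposition.transpose_def)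
qed

lemma perm_rep_hom: "perm_rep n \<in> hom (twin_group n) (sym_group n)"
  unfolding perm_rep_def
  using transpose_neighbours_permutes transpose_neighbours_commute
  by (intro hom_from_twin(1)[OF sym_group_is_group])
    (simp_all add: sym_group_carrier sym_group_mult sym_group_one del: One_nat_def)

lemma perm_rep_tw:
  assumes "w \<in> lists {1..n-1}"
  shows "perm_rep n (tw n w) = word_perm w"
proof -
  have "perm_rep n (tw n w) =
      word_value (sym_group n) (\<lambda>i. Transposition.transpose i (i + 1)) (gens w)"
    unfolding perm_rep_def
    using transpose_neighbours_permutes transpose_neighbours_commute assms
    by (intro hom_from_twin(2)[OF sym_group_is_group])
      (simp_all add: sym_group_carrier sym_group_mult sym_group_one del: One_nat_def)
  also have "\<dots> = word_perm w"
    by (induction w) (simp_all add: sym_group_mult sym_group_one)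
  finally show ?thesis .
qed

lemma word_perm_append: "word_perm (u @ v) = word_perm u \<circ> word_perm v"
  by (induction u) (simp_all add: o_assoc)

lemma word_perm_permutes: "w \<in> lists {1..n-1} \<Longrightarrow> word_perm w permutes {1..n}"
proof (induction w)
  case (Cons i w)
  then show ?case
    unfolding word_perm.simps
    by (intro permutes_compose transpose_neighbours_permutes) simp_all
qed (simp add: permutes_id)

lemma evenperm_word_perm: "evenperm (word_perm w) \<longleftrightarrow> even (length w)"
proof -
  have "permutation (word_perm w) \<and> (evenperm (word_perm w) \<longleftrightarrow> even (length w))"
  proof (induction w)
    case (Cons i w)
    have "permutation (Transposition.transpose i (i + 1) \<circ> word_perm w)"
      using Cons by (intro permutation_compose permutation_swap_id) simp
    moreover have "evenperm (Transposition.transpose i (i + 1) \<circ> word_perm w) \<longleftrightarrow> odd (length w)"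
      using Cons evenperm_comp[OF permutation_swap_id[of i "i + 1"], of "word_perm w"]
      by (simp add: evenperm_swap)
    ultimately show ?case unfolding word_perm.simps length_Cons even_Suc by (rule conjI)
  qed (simp add: evenperm_id permutation_id)
  then show ?thesis by blast
qed

lemma transposition_is_word_perm:
  assumes "a < b" "a \<in> {1..n}" "b \<in> {1..n}"
  shows "\<exists>w\<in>lists {1..n-1}. word_perm w = Transposition.transpose a b"
  using Suc_leI[OF assms(1)] assms(3)
proof (induction b rule: dec_induct)
  case base
  then have "[a] \<in> lists {1..n-1}" using assms(2) by auto
  then show ?case by (intro bexI[of _ "[a]"]) simp_all
next
  case (step b)
  then obtain w where w: "w \<in> lists {1..n-1}" "word_perm w = Transposition.transpose a b"
    by auto
  have "Transposition.transpose a (Suc b) =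
      Transposition.transpose b (Suc b) \<circ> (Transposition.transpose a b \<circ> Transposition.transpose b (Suc b))"
    using step(1) by (auto simp: fun_eq_iff Transposition.transpose_def)
  then have "word_perm (b # w @ [b]) = Transposition.transpose a (Suc b)"
    using w(2) by (simp add: word_perm_append)
  moreover have "b # w @ [b] \<in> lists {1..n-1}"
    using w(1) step by auto
  ultimately show ?case by blast
qed

lemma permutation_is_word_perm:
  assumes "p permutes {1..n}"
  shows "\<exists>w\<in>lists {1..n-1}. word_perm w = p"
  using assms finite_atLeastAtMost
proof (induction rule: permutes_induct)
  case id
  show ?case by (intro bexI[of _ "[]"]) simp_all
next
  case (swap a b p)
  obtain u where u: "u \<in> lists {1..n-1}" "word_perm u = Transposition.transpose a b"
    using swap(1-3) transposition_is_word_perm[of a b n] transposition_is_word_perm[of b a n]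
      transpose_commute[of a b] by (metis linorder_neq_iff)
  obtain v where v: "v \<in> lists {1..n-1}" "word_perm v = p"
    using swap by blast
  show ?case
    using u v by (intro bexI[of _ "u @ v"]) (simp_all add: word_perm_append)
qed

text \<open>
  Modulo \<open>3\<close> the matrix \<open>X\<^sub>i\<close> is, up to the signs \<open>(-1) ^ j\<close> of the basis vectors, the
  reflection of the root lattice spanned by the \<open>\<epsilon>\<^sub>j - \<epsilon>\<^bsub>j + 1\<^esub>\<close> that exchanges \<open>\<epsilon>\<^sub>i\<close> and
  \<open>\<epsilon>\<^bsub>i + 1\<^esub>\<close>. The following function is the \<open>r\<close>-th coordinate, with respect to the \<open>\<epsilon>\<^sub>r\<close>, of
  the \<open>c\<close>-th column; a word permutes these coordinates.
\<close>

definition root_coord :: "nat \<Rightarrow> nat list \<Rightarrow> nat \<Rightarrow> nat \<Rightarrow> int" where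
  "root_coord n w r c = (-1) ^ r * (tits_word n w r c + tits_word n w (r - 1) c)"

lemma root_coord_Cons:
  assumes i: "i \<in> {1..n-1}" and s: "s \<ge> 1"
  shows "[root_coord n (i # w) (Transposition.transpose i (i + 1) s) c = root_coord n w s c] (mod 3)"
proof -
  let ?E = "\<lambda>r. tits_word n w r c"
  have index: "i + 1 - 1 = i" "i - 1 \<noteq> i" "i + 1 \<noteq> i" using i by auto
  consider "s = i" | "s = i + 1" | "s \<noteq> i" "s \<noteq> i + 1" by blast
  then show ?thesis
  proof cases
    case 1
    have "root_coord n (i # w) (i + 1) c - root_coord n w i c =
        3 * ((-1) ^ (i + 1) * (?E (i - 1) + ?E (i + 1)))"
      unfolding root_coord_def tits_word.simps(2)
      by (simp only: index if_True if_False simp_thms) (simp add: algebra_simps)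
    then show ?thesis using 1 by (simp add: cong_iff_dvd_diff)
  next
    case 2
    have "root_coord n (i # w) i c - root_coord n w (i + 1) c =
        3 * ((-1) ^ i * (?E (i - 1) + ?E (i + 1)))"
      unfolding root_coord_def tits_word.simps(2)
      by (simp only: index if_True if_False simp_thms) (simp add: algebra_simps)
    then show ?thesis using 2 by (simp add: cong_iff_dvd_diff)
  next
    case 3
    have "s - 1 \<noteq> i" using 3 s by auto
    with 3 show ?thesis by (simp add: root_coord_def Transposition.transpose_def)
  qed
qed

lemma root_coord_word_perm:
  assumes "w \<in> lists {1..n-1}" "r \<in> {1..n}"
  shows "[root_coord n w (word_perm w r) c = root_coord n [] r c] (mod 3)"
  using assms(1)
proof (induction w)
  case (Cons i w)
  then have i: "i \<in> {1..n-1}" and w: "w \<in> lists {1..n-1}" by auto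
  have "word_perm w r \<in> {1..n}"
    using permutes_in_image[OF word_perm_permutes[OF w]] assms(2) by blast
  then have "[root_coord n (i # w) (word_perm (i # w) r) c = root_coord n w (word_perm w r) c] (mod 3)"
    using root_coord_Cons[OF i, of "word_perm w r" w c] by simp
  then show ?case using Cons.IH by (rule cong_trans)
qed simp

text \<open>
  The root \<open>\<epsilon>\<^sub>c - \<epsilon>\<^bsub>c + 1\<^esub>\<close> has its nonzero coordinates at \<open>c\<close> and \<open>c + 1\<close>; for \<open>n \<ge> 3\<close> the
  set of all \<open>c\<close> whose root is nonzero at \<open>r\<close> determines \<open>r\<close>.
\<close>

lemma root_coord_Nil_inj:
  assumes n: "n \<ge> 3" and rs: "r \<in> {1..n}" "s \<in> {1..n}"
    and cong: "\<And>c. c \<in> {1..n-1} \<Longrightarrow> [root_coord n [] s c = root_coord n [] r c] (mod 3)"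
  shows "s = r"
proof -
  have nz: "\<not> [(-1) ^ k = (0::int)] (mod 3)" "\<not> [0 = (-1::int) ^ k] (mod 3)" for k
    by (cases "even k"; simp add: cong_def)+
  have coord: "root_coord n [] r c = (if c = r \<or> c + 1 = r then (-1) ^ r else 0)"
    if "c \<in> {1..n-1}" "r \<in> {1..n}" for r c
    using that by (auto simp: root_coord_def)
  have support: "c = s \<or> c + 1 = s \<longleftrightarrow> c = r \<or> c + 1 = r" if "c \<in> {1..n-1}" for c
    using cong[OF that] nz unfolding coord[OF that rs(1)] coord[OF that rs(2)]
    by (cases "c = r \<or> c + 1 = r"; cases "c = s \<or> c + 1 = s") (simp_all only: if_True if_False simp_thms)
  have no: False
    if "a < b" "a \<in> {1..n}" "b \<in> {1..n}"
      and *: "\<And>c. c \<in> {1..n-1} \<Longrightarrow> c = a \<or> c + 1 = a \<longleftrightarrow> c = b \<or> c + 1 = b" for a b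
  proof -
    have "b - 1 \<in> {1..n-1}" using that(1-3) by auto
    from *[OF this] that(1-3) have b: "b = a + 1" by auto
    show False
    proof (cases "a = 1")
      case True
      moreover have "2 \<in> {1..n-1}" using n by auto
      ultimately show False using *[of 2] b by auto
    next
      case False
      then have "a - 1 \<in> {1..n-1}" using that(2) by auto
      from *[OF this] that(2) b False show False by auto
    qed
  qed
  have "\<not> s < r"
    using no[OF _ rs(2,1) support] by blast
  moreover have "\<not> r < s"
    using no[OF _ rs support[symmetric]] by blast
  ultimately show ?thesis by simp
qed

text \<open>
  If the permutation is trivial, then by \<open>root_coord_word_perm\<close> sums of consecutive rows agree with
  those of the identity modulo \<open>3\<close>, and as row \<open>0\<close> vanishes, so do the rows themselves. Conversely,
  a matrix that is the identity modulo \<open>3\<close> fixes all roots, hence all coordinates.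
\<close>

lemma word_perm_eq_id_iff:
  assumes n: "n \<ge> 3" and w: "w \<in> lists {1..n-1}"
  shows "word_perm w = id \<longleftrightarrow> tw n w \<in> congruence_subgroup n 3"
proof
  assume id: "word_perm w = id"
  have rows: "[tits_word n w r c = tits_word n [] r c] (mod 3)" if "r \<le> n" for r c
    using that
  proof (induction r)
    case 0
    then show ?case using tits_word_boundary[OF w] by simp
  next
    case (Suc r)
    define X where "X = (tits_word n w (Suc r) c - tits_word n [] (Suc r) c) +
        (tits_word n w r c - tits_word n [] r c)"
    have "[root_coord n w (Suc r) c = root_coord n [] (Suc r) c] (mod 3)"
      using root_coord_word_perm[OF w, of "Suc r" c] Suc.prems id by simp
    moreover have "root_coord n w (Suc r) c - root_coord n [] (Suc r) c = (-1) ^ Suc r * X"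
      unfolding root_coord_def X_def diff_Suc_1 by (simp only: algebra_simps)
    ultimately have "3 dvd (-1) ^ Suc r * X"
      by (simp only: cong_iff_dvd_diff)
    then have "3 dvd X"
      by (cases "even r") simp_all
    moreover have "3 dvd tits_word n w r c - tits_word n [] r c"
      using Suc.IH[OF Suc_leD[OF Suc.prems]] unfolding cong_iff_dvd_diff .
    ultimately show ?case
      unfolding cong_iff_dvd_diff X_def by (simp only: dvd_add_left_iff)
  qed
  have "[tits_word n w r c = tits_word n [] r c] (mod int 3)" if "r \<in> {1..n-1}" for r c
  proof -
    have "r \<le> n" using that by auto
    then show ?thesis unfolding of_nat_numeral by (rule rows)
  qed
  then show "tw n w \<in> congruence_subgroup n 3"
    unfolding tw_mem_congruence_subgroup_iff[OF w] by blast
next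
  assume mem: "tw n w \<in> congruence_subgroup n 3"
  have rows: "[tits_word n w r c = tits_word n [] r c] (mod 3)" if "c \<in> {1..n-1}" for r c
  proof (cases "r \<in> {1..n-1}")
    case True
    with mem that show ?thesis
      unfolding tw_mem_congruence_subgroup_iff[OF w] of_nat_numeral by blast
  next
    case False
    then have "r = 0 \<or> r \<ge> n" using n by auto
    then show ?thesis using tits_word_boundary[OF w] by auto
  qed
  have "word_perm w r = r" if r: "r \<in> {1..n}" for r
  proof (rule root_coord_Nil_inj[OF n r])
    show "word_perm w r \<in> {1..n}"
      using permutes_in_image[OF word_perm_permutes[OF w]] r by blast
    fix c
    assume c: "c \<in> {1..n-1}"
    have "[root_coord n [] (word_perm w r) c = root_coord n w (word_perm w r) c] (mod 3)"
      unfolding root_coord_def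
      by (intro cong_mult cong_add cong_sym[OF rows[OF c]] cong_refl)
    then show "[root_coord n [] (word_perm w r) c = root_coord n [] r c] (mod 3)"
      using root_coord_word_perm[OF w r] by (rule cong_trans)
  qed
  then have "word_perm w r = r" for r
    using permutes_not_in[OF word_perm_permutes[OF w]] by blast
  then show "word_perm w = id"
    by (simp add: fun_eq_iff)
qed

lemma perm_rep_kernel:
  assumes "n \<ge> 3" "x \<in> carrier (twin_group n)"
  shows "perm_rep n x = \<one>\<^bsub>sym_group n\<^esub> \<longleftrightarrow> x \<in> congruence_subgroup n 3"
proof -
  obtain w where w: "w \<in> lists {1..n-1}" "x = tw n w"
    using assms(2) unfolding carrier_twin by blast
  show ?thesis
    unfolding w(2) perm_rep_tw[OF w(1)] sym_group_one by (rule word_perm_eq_id_iff[OF assms(1) w(1)])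
qed

lemma perm_rep_congruence_subgroup:
  assumes "m \<ge> 3" "\<not> 3 dvd m"
  shows "perm_rep n ` congruence_subgroup n m = carrier (alt_group n)"
proof -
  interpret group_hom "twin_group n" "sym_group n" "perm_rep n"
    using group_twin sym_group_is_group perm_rep_hom
    by (simp add: group_hom_def group_hom_axioms_def)
  have "coprime (3::nat) m"
    using assms(2) prime_imp_coprime[of 3 m] by simp
  moreover have "perm_rep n (tw n [i, i + 1]) [^]\<^bsub>sym_group n\<^esub> (3::nat) = \<one>\<^bsub>sym_group n\<^esub>"
    if i: "i \<in> {1..n-1}" "i + 1 \<in> {1..n-1}" for i
  proof -
    have l: "[i, i + 1] \<in> lists {1..n-1}" "concat (replicate 3 [i, i + 1]) \<in> lists {1..n-1}"
      using i by (simp_all add: numeral_3_eq_3)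
    have eq: "perm_rep n (tw n [i, i + 1]) [^]\<^bsub>sym_group n\<^esub> (3::nat) = word_perm (concat (replicate 3 [i, i + 1]))"
      unfolding hom_nat_pow[OF tw_closed[OF l(1)], symmetric] tw_pow[OF l(1)] by (rule perm_rep_tw[OF l(2)])
    have "word_perm (concat (replicate 3 [i, i + 1])) x = x" for x
    proof -
      consider "x = i" | "x = Suc i" | "x = Suc (Suc i)" | "x \<noteq> i" "x \<noteq> Suc i" "x \<noteq> Suc (Suc i)"
        by blast
      then show ?thesis
        by cases (simp_all add: numeral_3_eq_3 transpose_apply_other)
    qed
    then have "word_perm (concat (replicate 3 [i, i + 1])) = id"
      by (simp only: fun_eq_iff id_apply simp_thms)
    with eq show ?thesis by (simp only: sym_group_one)
  qed
  ultimately have "perm_rep n ` congruence_subgroup n m =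
      {perm_rep n (tw n w) | w. w \<in> lists {1..n-1} \<and> even (length w)}"
    by (intro image_congruence_subgroup_eq_even_words[OF assms(1) sym_group_is_group perm_rep_hom])
  also have "\<dots> = {word_perm w | w. w \<in> lists {1..n-1} \<and> evenperm (word_perm w)}"
    unfolding evenperm_word_perm setcompr_eq_image
    by (rule image_cong[OF HOL.refl]) (simp only: mem_Collect_eq perm_rep_tw)
  also have "\<dots> = carrier (alt_group n)"
  proof (intro equalityI subsetI)
    fix p
    assume "p \<in> {word_perm w | w. w \<in> lists {1..n-1} \<and> evenperm (word_perm w)}"
    then show "p \<in> carrier (alt_group n)"
      using word_perm_permutes unfolding alt_group_carrier by blast
  next
    fix p
    assume "p \<in> carrier (alt_group n)"
    then have p: "p permutes {1..n}" "evenperm p" unfolding alt_group_carrier by blast+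
    then show "p \<in> {word_perm w | w. w \<in> lists {1..n-1} \<and> evenperm (word_perm w)}"
      using permutation_is_word_perm[OF p(1)] by blast
  qed
  finally show ?thesis .
qed

section \<open>Level four and the Coxeter group with all exponents two\<close>

lemma involutive_presentation_coxeter2: "involutive_presentation {1..n-1} (coxeter2_relations n)"
  by unfold_locales (auto simp: coxeter2_relations_def)

interpretation cox: involutive_presentation "{1..n-1}" "coxeter2_relations n" for n
  by (rule involutive_presentation_coxeter2)

abbreviation cx :: "nat \<Rightarrow> nat list \<Rightarrow> nat sword set" where
  "cx n w \<equiv> word_class {1..n-1} (coxeter2_relations n) (gens w)"

lemma group_coxeter2: "group (coxeter2_group n)"
  unfolding coxeter2_group_def by (rule cox.group_P)

lemmas mult_coxeter2 = cox.mult_elt[folded coxeter2_group_def]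
lemmas cx_closed = cox.elt_closed[folded coxeter2_group_def]
lemmas one_coxeter2 = cox.one_elt[folded coxeter2_group_def]
lemmas inv_coxeter2 = cox.inv_elt[folded coxeter2_group_def]

lemma cx_pair_square:
  assumes "i \<in> {1..n-1}" "j \<in> {1..n-1}"
  shows "cx n [i, j, i, j] = \<one>\<^bsub>coxeter2_group n\<^esub>"
proof (cases "i = j")
  case True
  then show ?thesis
    using cox.elt_square[OF assms(1), of "[]" "[i, i]"] cox.elt_square[OF assms(1), of "[]" "[]"] assms
    by (simp add: one_coxeter2)
next
  case False
  then have "(gens [i, j, i, j], []) \<in> coxeter2_relations n"
    using assms unfolding coxeter2_relations_def by blast
  from word_eq.relation[OF this, of "{1..n-1}" "[]" "[]"] show ?thesis
    unfolding one_coxeter2 using assms by (subst cox.cls_eq_iff) simp_all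
qed

text \<open>
  The word \<open>u\<^sub>i u\<^sub>j\<close> squares to \<open>1\<close>, so it equals its own inverse \<open>u\<^sub>j u\<^sub>i\<close>.
\<close>

lemma cx_commute:
  assumes "i \<in> {1..n-1}" "j \<in> {1..n-1}"
  shows "cx n [i, j] = cx n [j, i]"
proof -
  interpret group "coxeter2_group n" by (rule group_coxeter2)
  have l: "[i, j] \<in> lists {1..n-1}" using assms by simp
  have "cx n [i, j] \<otimes>\<^bsub>coxeter2_group n\<^esub> cx n [i, j] = \<one>\<^bsub>coxeter2_group n\<^esub>"
    using cx_pair_square[OF assms] unfolding mult_coxeter2[OF l l] by simp
  then have "inv\<^bsub>coxeter2_group n\<^esub> (cx n [i, j]) = cx n [i, j]"
    using cx_closed[OF l] by (intro inv_equality)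
  then show ?thesis unfolding inv_coxeter2[OF l] by simp
qed

lemma cx_move:
  assumes "i \<in> {1..n-1}" "u \<in> lists {1..n-1}" "v \<in> lists {1..n-1}"
  shows "cx n (i # u @ v) = cx n (u @ i # v)"
  using assms(2)
proof (induction u)
  case (Cons j u)
  then have j: "j \<in> {1..n-1}" and u: "u \<in> lists {1..n-1}" by simp_all
  have l: "[i, j] \<in> lists {1..n-1}" "[j, i] \<in> lists {1..n-1}" "[j] \<in> lists {1..n-1}"
    "u @ v \<in> lists {1..n-1}" "i # u @ v \<in> lists {1..n-1}" "u @ i # v \<in> lists {1..n-1}"
    using assms j u by simp_all
  have "cx n ([i, j] @ u @ v) = cx n ([j, i] @ u @ v)"
    unfolding mult_coxeter2[OF l(1,4), symmetric] mult_coxeter2[OF l(2,4), symmetric]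
    by (simp only: cx_commute[OF assms(1) j])
  also have "\<dots> = cx n ([j] @ i # u @ v)" by simp
  also have "\<dots> = cx n ([j] @ u @ i # v)"
    unfolding mult_coxeter2[OF l(3,5), symmetric] mult_coxeter2[OF l(3,6), symmetric]
    by (simp only: Cons.IH)
  finally show ?case by simp
qed simp

lemma coxeter2_word_eq_parity:
  "word_eq {1..n-1} (coxeter2_relations n) u v \<Longrightarrow>
    even (count_list (map snd u) a) \<longleftrightarrow> even (count_list (map snd v) a)"
proof (induction rule: word_eq.induct)
  case (relation l r u v)
  then have "even (count_list (map snd l) a) \<and> r = []"
    unfolding coxeter2_relations_def by auto
  then show ?case by simp
qed simp_all

text \<open>
  The generators commute and are involutions, so a letter that occurs an even number of times
  can be collected and cancelled in pairs.
\<close>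

lemma cx_eq_one_iff:
  assumes "w \<in> lists {1..n-1}"
  shows "cx n w = \<one>\<^bsub>coxeter2_group n\<^esub> \<longleftrightarrow> (\<forall>a. even (count_list w a))"
proof
  assume "cx n w = \<one>\<^bsub>coxeter2_group n\<^esub>"
  then have eq: "word_eq {1..n-1} (coxeter2_relations n) (gens w) (gens [])"
    unfolding one_coxeter2 using assms by (subst (asm) cox.cls_eq_iff) simp_all
  have "map snd (gens w) = w" by (simp add: gens_def comp_def)
  then show "\<forall>a. even (count_list w a)"
    using coxeter2_word_eq_parity[OF eq] by simp
next
  assume "\<forall>a. even (count_list w a)"
  then show "cx n w = \<one>\<^bsub>coxeter2_group n\<^esub>"
    using assms
  proof (induction w rule: length_induct)
    case (1 w)
    show ?case
    proof (cases w)
      case (Cons i v)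
      have "odd (count_list v i)"
        using 1(2)[rule_format, of i] Cons by simp
      then have "i \<in> set v"
        using count_list_0_iff[of v i] by fastforce
      then obtain x y where v: "v = x @ i # y"
        using split_list by fast
      have i: "i \<in> {1..n-1}" and x: "x \<in> lists {1..n-1}" and y: "y \<in> lists {1..n-1}"
        using 1(3) unfolding Cons v by simp_all
      have "cx n w = cx n (x @ i # i # y)"
        unfolding Cons v using i x y by (intro cx_move) simp_all
      also have "\<dots> = cx n (x @ y)"
        by (rule cox.elt_square[OF i x y])
      also have "\<dots> = \<one>\<^bsub>coxeter2_group n\<^esub>"
      proof -
        have "even (count_list (x @ y) a)" for a
          using 1(2)[rule_format, of a] unfolding Cons v by (cases "a = i") simp_all
        moreover have "length (x @ y) < length w" unfolding Cons v by simp
        moreover have "x @ y \<in> lists {1..n-1}" using x y by simp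
        ultimately show ?thesis using 1(1) by blast
      qed
      finally show ?thesis .
    qed (simp add: one_coxeter2)
  qed
qed

definition parity_rep :: "nat \<Rightarrow> nat sword set \<Rightarrow> nat sword set" where
  "parity_rep n = induced_hom (coxeter2_group n) (\<lambda>i. cx n [i])"

lemma parity_rep_hom: "parity_rep n \<in> hom (twin_group n) (coxeter2_group n)"
  and parity_rep_tw: "w \<in> lists {1..n-1} \<Longrightarrow> parity_rep n (tw n w) = cx n w"
proof -
  have single: "[i] \<in> lists {1..n-1}" if "i \<in> {1..n-1}" for i
    using that by simp
  have mult: "cx n [i] \<otimes>\<^bsub>coxeter2_group n\<^esub> cx n [j] = cx n [i, j]"
    if "i \<in> {1..n-1}" "j \<in> {1..n-1}" for i j
    unfolding mult_coxeter2[OF single[OF that(1)] single[OF that(2)]] by simp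
  have sq: "cx n [i] \<otimes>\<^bsub>coxeter2_group n\<^esub> cx n [i] = \<one>\<^bsub>coxeter2_group n\<^esub>" if "i \<in> {1..n-1}" for i
    using cox.elt_square[OF that, of "[]" "[]"] unfolding mult[OF that that] one_coxeter2 by simp
  have comm: "cx n [i] \<otimes>\<^bsub>coxeter2_group n\<^esub> cx n [j] = cx n [j] \<otimes>\<^bsub>coxeter2_group n\<^esub> cx n [i]"
    if "i \<in> {1..n-1}" "j \<in> {1..n-1}" for i j
    unfolding mult[OF that] mult[OF that(2,1)] by (rule cx_commute[OF that])
  show "parity_rep n \<in> hom (twin_group n) (coxeter2_group n)"
    unfolding parity_rep_def
    by (rule hom_from_twin(1)[OF group_coxeter2 cx_closed[OF single] sq comm])
  assume w: "w \<in> lists {1..n-1}"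
  have "parity_rep n (tw n w) = word_value (coxeter2_group n) (\<lambda>i. cx n [i]) (gens w)"
    unfolding parity_rep_def
    by (rule hom_from_twin(2)[OF group_coxeter2 cx_closed[OF single] sq comm w])
  also have "\<dots> = cx n w"
    using w
  proof (induction w)
    case (Cons i w)
    then have "cx n [i] \<otimes>\<^bsub>coxeter2_group n\<^esub> cx n w = cx n ([i] @ w)"
      by (intro mult_coxeter2) simp_all
    with Cons show ?case by simp
  qed (simp add: one_coxeter2)
  finally show "parity_rep n (tw n w) = cx n w" .
qed

text \<open>
  Modulo \<open>4\<close> we have \<open>X\<^sub>i = 1 + 2 N\<^sub>i\<close>, and \<open>(1 + 2 A) (1 + 2 B) = 1 + 2 (A + B)\<close>; hence the matrix
  of a word is \<open>1 + 2 \<Sum>\<^sub>r c\<^sub>r N\<^sub>r\<close>, where \<open>c\<^sub>r\<close> counts the letter \<open>r\<close>. The matrices \<open>N\<^sub>r\<close> are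
  nonzero modulo \<open>2\<close> in different rows, so the parities of the \<open>c\<^sub>r\<close> can be read off.
\<close>

lemma tits_word_mod_4:
  assumes w: "w \<in> lists {1..n-1}" and c: "c \<in> {1..n-1}"
  shows "[tits_word n w r c = tits_word n [] r c +
    2 * (int (count_list w r) * (if r = c \<or> r = c + 1 \<or> r + 1 = c then 1 else 0))] (mod 4)"
  using w
proof (induction w arbitrary: r)
  case (Cons i w)
  define d where "d r = tits_word n [] r c" for r
  define E where "E r = tits_word n w r c" for r
  define N where "N r = (if r = c \<or> r = c + 1 \<or> r + 1 = c then 1 else (0::int))" for r
  have i: "i \<in> {1..n-1}" using Cons by blast
  have IH: "[E r = d r + 2 * (int (count_list w r) * N r)] (mod 4)" for r
    using Cons unfolding E_def d_def N_def by simp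
  show ?case
  proof (cases "r = i")
    case False
    then show ?thesis using IH[of r] by (simp add: E_def d_def N_def)
  next
    case True
    obtain x where x: "E i - (d i + 2 * (int (count_list w i) * N i)) = 4 * x"
      using IH[of i] unfolding cong_iff_dvd_diff by (rule dvdE)
    obtain y where y: "E (i - 1) - (d (i - 1) + 2 * (int (count_list w (i - 1)) * N (i - 1))) = 4 * y"
      using IH[of "i - 1"] unfolding cong_iff_dvd_diff by (rule dvdE)
    obtain z where z: "E (i + 1) - (d (i + 1) + 2 * (int (count_list w (i + 1)) * N (i + 1))) = 4 * z"
      using IH[of "i + 1"] unfolding cong_iff_dvd_diff by (rule dvdE)
    have "d i + d (i - 1) + d (i + 1) = N i"
      using i c by (auto simp: d_def N_def)
    with x y z have "2 * E (i - 1) - E i + 2 * E (i + 1) - (d i + 2 * ((int (count_list w i) + 1) * N i)) =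
      4 * (int (count_list w (i - 1)) * N (i - 1) + int (count_list w (i + 1)) * N (i + 1) + 2 * y + 2 * z
        - x - int (count_list w i) * N i - d i)"
      by (simp add: algebra_simps)
    then have "[2 * E (i - 1) - E i + 2 * E (i + 1) = d i + 2 * ((int (count_list w i) + 1) * N i)] (mod 4)"
      unfolding cong_iff_dvd_diff by (simp only: dvd_triv_left)
    moreover have "int (count_list (i # w) i) = int (count_list w i) + 1" by simp
    moreover have "tits_word n (i # w) i c = 2 * E (i - 1) - E i + 2 * E (i + 1)"
      unfolding E_def by simp
    ultimately show ?thesis
      unfolding True d_def N_def by (simp only:)
  qed
qed simp

lemma parity_rep_kernel:
  assumes "x \<in> carrier (twin_group n)"
  shows "parity_rep n x = \<one>\<^bsub>coxeter2_group n\<^esub> \<longleftrightarrow> x \<in> congruence_subgroup n 4"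
proof -
  obtain w where w: "w \<in> lists {1..n-1}" "x = tw n w"
    using assms unfolding carrier_twin by blast
  have four: "(4::int) dvd 2 * k \<longleftrightarrow> even k" for k :: int
    using dvd_mult_cancel_left[of 2 2 k] by simp
  have entry: "[tits_word n w r c = tits_word n [] r c] (mod 4) \<longleftrightarrow>
      even (int (count_list w r) * (if r = c \<or> r = c + 1 \<or> r + 1 = c then 1 else 0))"
    if c: "c \<in> {1..n-1}" for r c
  proof -
    define k where "k = int (count_list w r) * (if r = c \<or> r = c + 1 \<or> r + 1 = c then 1 else 0)"
    have k: "4 dvd tits_word n w r c - (tits_word n [] r c + 2 * k)"
      using tits_word_mod_4[OF w(1) c, of r] unfolding cong_iff_dvd_diff k_def .
    have "tits_word n w r c - tits_word n [] r c = (tits_word n w r c - (tits_word n [] r c + 2 * k)) + 2 * k"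
      by (simp del: tits_word.simps)
    then have "4 dvd tits_word n w r c - tits_word n [] r c \<longleftrightarrow> 4 dvd 2 * k"
      using dvd_add_right_iff[OF k, of "2 * k"] by (simp only:)
    then show ?thesis
      unfolding cong_iff_dvd_diff four k_def .
  qed
  have "tw n w \<in> congruence_subgroup n 4 \<longleftrightarrow> (\<forall>a. even (count_list w a))"
  proof
    assume "\<forall>a. even (count_list w a)"
    then have "[tits_word n w r c = tits_word n [] r c] (mod 4)" if "c \<in> {1..n-1}" for r c
      unfolding entry[OF that] by simp
    then show "tw n w \<in> congruence_subgroup n 4"
      unfolding tw_mem_congruence_subgroup_iff[OF w(1)] of_nat_numeral by blast
  next
    assume mem: "tw n w \<in> congruence_subgroup n 4"
    show "\<forall>a. even (count_list w a)"
    proof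
      fix a
      show "even (count_list w a)"
      proof (cases "a \<in> {1..n-1}")
        case True
        then have "[tits_word n w a a = tits_word n [] a a] (mod 4)"
          using mem unfolding tw_mem_congruence_subgroup_iff[OF w(1)] of_nat_numeral by blast
        then show ?thesis unfolding entry[OF True] by simp
      next
        case False
        then have "a \<notin> set w" using w(1) by auto
        then show ?thesis by simp
      qed
    qed
  qed
  then show ?thesis
    unfolding w(2) parity_rep_tw[OF w(1)] cx_eq_one_iff[OF w(1)] by (rule HOL.sym)
qed

lemma parity_rep_congruence_subgroup:
  assumes "m \<ge> 3" "odd m"
  shows "parity_rep n ` congruence_subgroup n m = even_words n"
proof -
  interpret group_hom "twin_group n" "coxeter2_group n" "parity_rep n"
    using group_twin group_coxeter2 parity_rep_hom
    by (simp add: group_hom_def group_hom_axioms_def)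
  have "parity_rep n (tw n [i, i + 1]) [^]\<^bsub>coxeter2_group n\<^esub> (2::nat) = \<one>\<^bsub>coxeter2_group n\<^esub>"
    if i: "i \<in> {1..n-1}" "i + 1 \<in> {1..n-1}" for i
  proof -
    have l: "[i, i + 1] \<in> lists {1..n-1}" using i by simp
    have "parity_rep n (tw n [i, i + 1]) [^]\<^bsub>coxeter2_group n\<^esub> (2::nat) =
        cx n [i, i + 1] \<otimes>\<^bsub>coxeter2_group n\<^esub> cx n [i, i + 1]"
      unfolding parity_rep_tw[OF l] numeral_2_eq_2 using cx_closed[OF l] by simp
    also have "\<dots> = cx n [i, i + 1, i, i + 1]"
      unfolding mult_coxeter2[OF l l] by simp
    also have "\<dots> = \<one>\<^bsub>coxeter2_group n\<^esub>"
      by (rule cx_pair_square[OF i])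
    finally show ?thesis .
  qed
  moreover have "coprime (2::nat) m" using assms(2) by simp
  ultimately have "parity_rep n ` congruence_subgroup n m =
      {parity_rep n (tw n w) | w. w \<in> lists {1..n-1} \<and> even (length w)}"
    by (intro image_congruence_subgroup_eq_even_words[OF assms(1) group_coxeter2 parity_rep_hom])
  also have "\<dots> = even_words n"
    unfolding even_words_def setcompr_eq_image word_class_def[symmetric]
    by (rule image_cong[OF HOL.refl]) (simp only: mem_Collect_eq parity_rep_tw)
  finally show ?thesis .
qed

section \<open>The three quotients\<close>

theorem theorem3p23:
  fixes n m :: nat
  assumes "n \<ge> 3" and "m \<ge> 2"
  shows "(\<not> 3 dvd m \<and> m \<noteq> 2 \<longrightarrow> congruence_quotient n m (3 * m) \<cong> alt_group n) \<and>
         (odd m \<longrightarrow> congruence_quotient n m (4 * m) \<cong> even_word_group n) \<and>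
         (odd m \<and> \<not> 3 dvd m \<longrightarrow>
            congruence_quotient n m (12 * m) \<cong> alt_group n \<times>\<times> even_word_group n)"
proof (intro conjI impI)
  have alt: "sym_group n\<lparr>carrier := carrier (alt_group n)\<rparr> = alt_group n"
    by (simp add: alt_group_def)
  have coprime3: "coprime 3 k" if "\<not> 3 dvd k" for k :: nat
    using that prime_imp_coprime[of 3 k] by simp
  have coprime4: "coprime 4 k" if "odd k" for k :: nat
    using that coprime_power_left_iff[of 2 2 k] by simp
  show "congruence_quotient n m (3 * m) \<cong> alt_group n" if m: "\<not> 3 dvd m \<and> m \<noteq> 2"
  proof -
    have m3: "m \<ge> 3" "\<not> 3 dvd m" using m assms(2) by auto
    have "congruence_quotient n m (3 * m) \<cong>
        sym_group n\<lparr>carrier := perm_rep n ` congruence_subgroup n m\<rparr>"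
      by (rule congruence_quotient_iso_image[OF sym_group_is_group perm_rep_hom coprime3[OF m3(2)]
            perm_rep_kernel[OF assms(1)]])
    then show ?thesis unfolding perm_rep_congruence_subgroup[OF m3] alt .
  qed
  show "congruence_quotient n m (4 * m) \<cong> even_word_group n" if m: "odd m"
  proof -
    have m3: "m \<ge> 3" using m assms(2) by (cases "m = 2") auto
    have "congruence_quotient n m (4 * m) \<cong>
        coxeter2_group n\<lparr>carrier := parity_rep n ` congruence_subgroup n m\<rparr>"
      by (rule congruence_quotient_iso_image[OF group_coxeter2 parity_rep_hom coprime4[OF m] parity_rep_kernel])
    then show ?thesis
      unfolding parity_rep_congruence_subgroup[OF m3 m] even_word_group_def .
  qed
  show "congruence_quotient n m (12 * m) \<cong> alt_group n \<times>\<times> even_word_group n"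
    if m: "odd m \<and> \<not> 3 dvd m"
  proof -
    define h where "h x = (perm_rep n x, parity_rep n x)" for x
    let ?T = "twin_group n" and ?P = "sym_group n \<times>\<times> coxeter2_group n"
    have m3: "m \<ge> 3" using m assms(2) by (cases "m = 2") auto
    have h: "h \<in> hom ?T ?P"
      using perm_rep_hom[of n] parity_rep_hom[of n] by (simp add: hom_def h_def Pi_iff)
    have ker: "h x = \<one>\<^bsub>?P\<^esub> \<longleftrightarrow> x \<in> congruence_subgroup n 12" if "x \<in> carrier ?T" for x
      using congruence_subgroup_coprime[OF coprime3[of 4], of n]
        perm_rep_kernel[OF assms(1) that] parity_rep_kernel[OF that]
      by (simp add: h_def)
    have "coprime 12 m"
      using coprime3[of m] coprime4[of m] m coprime_mult_left_iff[of 3 4 m] by simp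
    then have "congruence_quotient n m (12 * m) \<cong> ?P\<lparr>carrier := h ` congruence_subgroup n m\<rparr>"
      using h ker by (intro congruence_quotient_iso_image DirProd_group sym_group_is_group group_coxeter2)
    moreover have "h ` congruence_subgroup n m = carrier (alt_group n) \<times> even_words n"
    proof
      show "h ` congruence_subgroup n m \<subseteq> carrier (alt_group n) \<times> even_words n"
        using perm_rep_congruence_subgroup[OF m3, of n] parity_rep_congruence_subgroup[OF m3, of n] m
        unfolding h_def by blast
      \<comment> \<open>Both components can be prescribed independently: level \<open>4 m\<close> still maps onto the
        even permutations, level \<open>3 m\<close> still maps onto the even words, and each of the two levels
        is invisible to the other homomorphism.\<close>
      show "carrier (alt_group n) \<times> even_words n \<subseteq> h ` congruence_subgroup n m"
      proof
        fix z
        assume "z \<in> carrier (alt_group n) \<times> even_words n"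
        then obtain p q where z: "z = (p, q)" "p \<in> carrier (alt_group n)" "q \<in> even_words n"
          by blast
        have 4: "4 * m \<ge> 3" "\<not> 3 dvd 4 * m"
          using m3 m coprime_dvd_mult_right_iff[OF coprime3[of 4], of m] by auto
        have 3: "3 * m \<ge> 3" "odd (3 * m)"
          using m3 m by auto
        obtain x where x: "x \<in> congruence_subgroup n (4 * m)" "p = perm_rep n x"
          using z(2) unfolding perm_rep_congruence_subgroup[OF 4, symmetric] by blast
        obtain y where y: "y \<in> congruence_subgroup n (3 * m)" "q = parity_rep n y"
          using z(3) unfolding parity_rep_congruence_subgroup[OF 3, symmetric] by blast
        have carr: "x \<in> carrier ?T" "y \<in> carrier ?T"
          using x y subgroup.subset[OF subgroup_congruence_subgroup] by blast+
        have xm: "x \<in> congruence_subgroup n m" "x \<in> congruence_subgroup n 4"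
          using x(1) congruence_subgroup_mono[of m "4 * m" n] congruence_subgroup_mono[of 4 "4 * m" n]
          by auto
        have ym: "y \<in> congruence_subgroup n m" "y \<in> congruence_subgroup n 3"
          using y(1) congruence_subgroup_mono[of m "3 * m" n] congruence_subgroup_mono[of 3 "3 * m" n]
          by auto
        interpret S: group "sym_group n" by (rule sym_group_is_group)
        interpret W: group "coxeter2_group n" by (rule group_coxeter2)
        have "perm_rep n (x \<otimes>\<^bsub>?T\<^esub> y) = p"
          using hom_mult[OF perm_rep_hom carr] perm_rep_kernel[OF assms(1) carr(2)] ym(2)
            hom_in_carrier[OF perm_rep_hom carr(1)] x(2)
          by simp
        moreover have "parity_rep n (x \<otimes>\<^bsub>?T\<^esub> y) = q"
          using hom_mult[OF parity_rep_hom carr] parity_rep_kernel[OF carr(1)] xm(2)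
            hom_in_carrier[OF parity_rep_hom carr(2)] y(2)
          by simp
        ultimately have "h (x \<otimes>\<^bsub>?T\<^esub> y) = z"
          unfolding h_def z(1) by simp
        moreover have "x \<otimes>\<^bsub>?T\<^esub> y \<in> congruence_subgroup n m"
          by (rule subgroup.m_closed[OF subgroup_congruence_subgroup xm(1) ym(1)])
        ultimately show "z \<in> h ` congruence_subgroup n m"
          by blast
      qed
    qed
    moreover have "?P\<lparr>carrier := carrier (alt_group n) \<times> even_words n\<rparr> =
        alt_group n \<times>\<times> even_word_group n"
      by (simp add: DirProd_def alt_group_def even_word_group_def)
    ultimately show ?thesis by simp
  qed
qed

end
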